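(* Let $k$ be an odd positive integer and let $\zeta$ be a primitive root of unity of order $2k$. Define, for $|q|<1$, \[ S_1(1;q):=2\sum_{n=0}^{\infty}\frac{(q;q^2)_n(-1)^nq^{(n+1)^2}}{(-q;q^2)_{n+1}^2}. \] Then, as $q$ approaches $\zeta$ radially within the unit disk, \[ \lim_{q\rightarrow \zeta} \Big ( S_1(1;q)+\frac{J_{1,2}^2}{\overline{J}_{0,1}}\Big )=-2\sum_{n=0}^{\frac{k-1}{2}}\frac{\zeta^{2n+1}(-\zeta;\zeta^2)_n^2}{(\zeta;\zeta^2)_{n+1}}. \]
   Context: Throughout, $q$ is a complex number with $0<|q|<1$. For $x\in\mathbb{C}$ and $n\ge 0$, $(x;q)_n:=\prod_{i=0}^{n-1}(1-xq^i)$ (also used with $q$ replaced by any other base, e.g. $(x;\zeta^2)_n=\prod_{i=0}^{n-1}(1-x\zeta^{2i})$) and $(x;q)_\infty:=\prod_{i\ge 0}(1-xq^i)$. The theta function is $j(x;q):=(x;q)_\infty(q/x;q)_\infty(q;q)_\infty$. For integers $a$ and $m>0$: $J_{a,m}:=j(q^a;q^m)$ and $\overline{J}_{a,m}:=j(-q^a;q^m)$. "$q$ approaches $\zeta$ radially" means $q=r\zeta$ with $r\to 1^-$. *)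

theory Defs
  imports "HOL-Analysis.Analysis"
begin

definition qpoch :: "complex \<Rightarrow> complex \<Rightarrow> nat \<Rightarrow> complex" where
  "qpoch x q n = (\<Prod>i<n. 1 - x * q ^ i)"

(* Used for norm q < 1 only, where the product converges (to 0 if some factor vanishes). *)
definition qpoch_inf :: "complex \<Rightarrow> complex \<Rightarrow> complex" where
  "qpoch_inf x q = (\<Prod>i. 1 - x * q ^ i)"

definition theta_j :: "complex \<Rightarrow> complex \<Rightarrow> complex" where
  "theta_j x q = qpoch_inf x q * qpoch_inf (q / x) q * qpoch_inf q q"

(* J a m q and J_bar a m q are J_{a,m} and its overlined variant, with the base q explicit;
   meaningful for m > 0 and 0 < norm q < 1. *)
definition J :: "int \<Rightarrow> nat \<Rightarrow> complex \<Rightarrow> complex" where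
  "J a m q = theta_j (q powi a) (q ^ m)"

definition J_bar :: "int \<Rightarrow> nat \<Rightarrow> complex \<Rightarrow> complex" where
  "J_bar a m q = theta_j (- (q powi a)) (q ^ m)"

(* The value S_1(1; q), as a function of q with norm q < 1. *)
definition S1_at_1 :: "complex \<Rightarrow> complex" where
  "S1_at_1 q =
     2 * (\<Sum>n. qpoch q (q ^ 2) n * (- 1) ^ n * q ^ ((n + 1) ^ 2)
                / (qpoch (- q) (q ^ 2) (n + 1)) ^ 2)"

definition primitive_root_of_unity :: "nat \<Rightarrow> complex \<Rightarrow> bool" where
  "primitive_root_of_unity n z \<longleftrightarrow>
     n > 0 \<and> z ^ n = 1 \<and> (\<forall>m. 0 < m \<and> m < n \<longrightarrow> z ^ m \<noteq> 1)"

end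

theory Submission
  imports Defs
begin

text \<open>
  For \<open>\<mu>(q) = \<Sum>\<^sub>n (- 1)\<^sup>n q\<^bsup>n^2\<^esup> (q;q\<^sup>2)\<^sub>n / (- q\<^sup>2;q\<^sup>2)\<^sub>n\<^sup>2\<close>, the second order mock theta function, one has
  \<open>S\<^sub>1(1;q) + J\<^sub>1\<^sub>,\<^sub>2\<^sup>2 / J_bar\<^sub>0\<^sub>,\<^sub>1 = \<mu>(q) / 2\<close>. Indeed, expanding the denominators of \<open>\<mu>\<close> and \<open>S\<^sub>1\<close> in
  partial fractions and summing the inner series (of type \<open>\<^sub>1\<phi>\<^sub>1\<close>) turns \<open>\<mu>\<close> and \<open>- 2 S\<^sub>1\<close> into the
  even and odd parts of the Lambert type series \<open>\<Sum>\<^sub>N (- 1)\<^sup>N q\<^bsup>N(N+1)/2\<^esup> / (1 + q\<^sup>N)\<close>, \<open>N \<in> \<int>\<close>, up to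
  a common factor; the whole series is a theta quotient, by the limit \<open>n \<rightarrow> \<infinity>\<close> of the same partial
  fraction expansion.

  The denominators of \<open>\<mu>\<close> do not vanish at \<open>\<zeta>\<close>, and its summand there is halved by \<open>n \<mapsto> n + k\<close>, so
  \<open>\<mu>\<close> converges radially to twice the sum over one period. That this sum equals the finite sum of the
  theorem follows because both are values of solutions of the same \<open>q\<close>-difference equation at the
  root of unity, where periodicity forces uniqueness.
\<close>

section \<open>Partial fractions of \<open>q\<close>-Pochhammer symbols\<close>

lemma qpoch_0 [simp]: "qpoch x q 0 = 1"
  by (simp add: qpoch_def)

lemma qpoch_Suc: "qpoch x q (Suc n) = qpoch x q n * (1 - x * q ^ n)"
  by (simp add: qpoch_def)

lemma qpoch_self_nonzero: "(\<And>i. i > 0 \<Longrightarrow> p ^ i \<noteq> 1) \<Longrightarrow> qpoch p p n \<noteq> 0"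
  by (simp add: qpoch_def flip: power_Suc)

lemma inverse_square_cancel:
  fixes w s x :: complex
  assumes "w \<noteq> 0" and "w\<^sup>2 * s = 1 / x\<^sup>2"
  shows "1 / (x * w)\<^sup>2 = s"
proof -
  have "1 / (x * w)\<^sup>2 = (1 / x\<^sup>2) / w\<^sup>2"
    by (simp add: power_mult_distrib)
  also have "\<dots> = s"
    using assms(1) by (simp flip: assms(2))
  finally show ?thesis .
qed

section \<open>Even case: partial fractions of \<open>1 / (- p;p)_n^2\<close>\<close>

lemma Suc_choose_two: "Suc n choose 2 = n + (n choose 2)"
  by (simp add: numeral_2_eq_2)

text \<open>The partial sums of the vanishing sum in \<open>even_orthogonality\<close> have a
  product form, which makes that sum accessible to induction. With \<open>e = p^(m+1)\<close> the
  step reduces to \<open>(1 - e p^N) - (1 + e) (1 - p^N) = - e (1 - p^(N-m-1))\<close>.\<close>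

lemma even_telescope:
  fixes p :: complex
  assumes p: "\<And>i. i > 0 \<Longrightarrow> p ^ i \<noteq> 1" and "m < N"
  shows "(\<Sum>j\<le>m. (if j = 0 then 1 else (- 1) ^ j * p ^ (j choose 2) * (1 + p ^ j))
             / (qpoch p p (N - j) * qpoch p p (N + j)))
         = (- 1) ^ m * p ^ (Suc m choose 2)
             / (qpoch p p (N - Suc m) * qpoch p p (N + m) * (1 - p ^ N))"
  using \<open>m < N\<close>
proof (induction m)
  case 0
  then obtain d where N: "N = Suc d"
    by (cases N) auto
  show ?case
    using p[of N] N by (simp add: qpoch_Suc numeral_2_eq_2 mult_ac)
next
  case (Suc m)
  then obtain d where N: "N = Suc (Suc m) + d"
    by (metis less_imp_Suc_add add_Suc_right add_Suc)
  define a c e u v w P where "a = qpoch p p d" and "c = qpoch p p (N + m)" and "e = p ^ Suc m"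
    and "u = 1 - p ^ Suc d" and "v = 1 - p ^ (N + Suc m)" and "w = 1 - p ^ N"
    and "P = (- 1) ^ m * p ^ (Suc m choose 2)"
  have nz: "a \<noteq> 0" "c \<noteq> 0" "u \<noteq> 0" "v \<noteq> 0" "w \<noteq> 0"
    using p[of "Suc d"] p[of "N + Suc m"] p[of N] N
    by (auto simp: a_def c_def u_def v_def w_def qpoch_self_nonzero p)
  have q: "qpoch p p (N - Suc m) = a * u" "qpoch p p (N + Suc m) = c * v"
          "qpoch p p (N - Suc (Suc m)) = a" "qpoch p p (Suc (N + m)) = c * v"
    by (simp_all add: N a_def c_def u_def v_def qpoch_Suc)
  have key: "v - (1 + e) * w = - e * u"
    by (simp add: v_def w_def u_def e_def N algebra_simps power_add)
  have "(\<Sum>j\<le>Suc m. (if j = 0 then 1 else (- 1) ^ j * p ^ (j choose 2) * (1 + p ^ j))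
             / (qpoch p p (N - j) * qpoch p p (N + j)))
        = P / (a * u * c * w) - P * (1 + e) / (a * u * (c * v))"
    using Suc by (simp add: q w_def c_def[symmetric] P_def e_def)
  also have "\<dots> = P * (v - (1 + e) * w) / (a * u * c * v * w)"
    using nz by (simp add: field_simps)
  also have "\<dots> = - P * e / (a * (c * v) * w)"
    unfolding key using nz by (simp add: field_simps)
  also have "\<dots> = (- 1) ^ Suc m * p ^ (Suc (Suc m) choose 2)
             / (qpoch p p (N - Suc (Suc m)) * qpoch p p (N + Suc m) * (1 - p ^ N))"
    unfolding q Suc_choose_two[of "Suc m"] by (simp add: P_def e_def w_def power_add)
  finally show ?case .
qed

text \<open>The weight folds \<open>j\<close> and \<open>- j\<close> in the bilateral family
  \<open>(- 1)^j p^(j(j-1)/2)\<close>. In essence this is the finite q-binomial theorem for the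
  product \<open>(p^(-N);p)_(2N)\<close>, which contains a vanishing factor once
  \<open>N > 0\<close>.\<close>

lemma even_orthogonality:
  fixes p :: complex
  assumes p: "\<And>i. i > 0 \<Longrightarrow> p ^ i \<noteq> 1" and "N > 0"
  shows "(\<Sum>j\<le>N. (if j = 0 then 1 else (- 1) ^ j * p ^ (j choose 2) * (1 + p ^ j))
             / (qpoch p p (N - j) * qpoch p p (N + j))) = 0"
proof -
  obtain m where N: "N = Suc m"
    using \<open>N > 0\<close> by (cases N) auto
  define c w y P where "c = qpoch p p (N + m)" and "w = 1 - p ^ N" and "y = p ^ N"
    and "P = (- 1) ^ m * p ^ (Suc m choose 2)"
  have q: "qpoch p p (N + Suc m) = c * (1 - y * y)"
    by (simp add: c_def N qpoch_Suc y_def power_add)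
  have nz: "c \<noteq> 0" "1 - y \<noteq> 0" "1 - y * y \<noteq> 0"
    using p[of N] p[of "N + N"] \<open>N > 0\<close> by (auto simp: c_def y_def qpoch_self_nonzero p power_add)
  \<comment> \<open>The closed form fails at \<open>m = N\<close>, where \<open>N - Suc m\<close>
    truncates to 0; it is used up to \<open>j = N - 1\<close> and the last term is added by
    hand.\<close>
  have T: "(\<Sum>j\<le>m. (if j = 0 then 1 else (- 1) ^ j * p ^ (j choose 2) * (1 + p ^ j))
             / (qpoch p p (N - j) * qpoch p p (N + j))) = P / (c * (1 - y))"
    using even_telescope[of p m N] p by (simp add: N P_def y_def c_def)
  have "(\<Sum>j\<le>Suc m. (if j = 0 then 1 else (- 1) ^ j * p ^ (j choose 2) * (1 + p ^ j))
             / (qpoch p p (N - j) * qpoch p p (N + j)))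
        = P / (c * (1 - y)) - P * (1 + y) / (c * (1 - y * y))"
    unfolding sum.atMost_Suc T q by (simp add: N P_def y_def)
  also have "\<dots> = 0"
    using nz by (simp add: field_simps)
  finally show ?thesis
    by (simp only: N)
qed

text \<open>For \<open>j > 0\<close> the coefficient is the sum of the \<open>j\<close>-th and \<open>(- j)\<close>-th terms of the bilateral
  family \<open>2 (- 1)\<^sup>j p\<^bsup>j(j+1)/2\<^esup> / (1 + p\<^sup>j)\<close>, which is symmetric under \<open>j \<mapsto> - j\<close>.\<close>

definition bailey_coeff :: "complex \<Rightarrow> nat \<Rightarrow> complex" where
  "bailey_coeff p j = (if j = 0 then 1 else 4 * (- 1) ^ j * p ^ (Suc j choose 2) / (1 + p ^ j))"

text \<open>With \<open>w = z y\<close> one has \<open>(1 + w)\<^sup>2 - (1 - w y) (1 - z) = z (1 + y)\<^sup>2\<close>; the first product lowers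
  \<open>n\<close> and the remainder is killed by the orthogonality relation.\<close>

lemma inverse_qpoch_square_even:
  fixes p :: complex
  assumes p: "\<And>i. i > 0 \<Longrightarrow> p ^ i \<noteq> 1" and p': "\<And>i. i > 0 \<Longrightarrow> p ^ i \<noteq> - 1"
  shows "1 / (qpoch (- p) p n)\<^sup>2
         = (\<Sum>j\<le>n. bailey_coeff p j / (qpoch p p (n - j) * qpoch p p (n + j)))"
proof (induction n)
  case 0
  show ?case
    by (simp add: bailey_coeff_def)
next
  case (Suc n)
  define w where "w = p ^ Suc n"
  define c where "c n j = 1 / (qpoch p p (n - j) * qpoch p p (n + j))" for n j
  define t where "t j = (if j = 0 then 1 else (- 1) ^ j * p ^ (j choose 2) * (1 + p ^ j))" for j
  define y z where "y j = p ^ j" and "z j = p ^ (Suc n - j)" for j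
  have w: "1 + w \<noteq> 0"
    using p'[of "Suc n"] by (simp add: w_def add_eq_0_iff)
  have split: "(1 + w)\<^sup>2 * (bailey_coeff p j * c (Suc n) j)
      = bailey_coeff p j * (c (Suc n) j * ((1 - w * y j) * (1 - z j))) + 4 * w * (t j * c (Suc n) j)"
    if "j \<le> Suc n" for j
  proof (cases "j = 0")
    case True
    then show ?thesis
      by (simp add: bailey_coeff_def t_def y_def z_def w_def power2_eq_square algebra_simps)
  next
    case False
    have wz: "w = z j * y j"
      using that by (simp add: w_def z_def y_def flip: power_add power_Suc)
    have y: "1 + y j \<noteq> 0"
      using p'[of j] False by (simp add: y_def add_eq_0_iff)
    define s where "s = (- 1) ^ j * p ^ (j choose 2)"
    have b: "bailey_coeff p j = 4 * s * y j / (1 + y j)" "t j = s * (1 + y j)"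
      using False by (simp_all add: bailey_coeff_def t_def s_def y_def Suc_choose_two power_add)
    have "(1 + z j * y j)\<^sup>2 * (4 * s * y j / (1 + y j) * C)
       = 4 * s * y j / (1 + y j) * (C * ((1 - z j * y j * y j) * (1 - z j)))
         + 4 * (z j * y j) * (s * (1 + y j) * C)" for C
      using y by (simp add: divide_simps power2_eq_square) (simp add: algebra_simps)
    then show ?thesis
      unfolding b wz by blast
  qed
  \<comment> \<open>At \<open>j = Suc n\<close> one has \<open>z j = p^0 = 1\<close>, so the factor
    \<open>1 - z j\<close> removes exactly the term that level \<open>n\<close> does not
    have.\<close>
  have step: "c (Suc n) j * ((1 - w * y j) * (1 - z j)) = (if j \<le> n then c n j else 0)"
    if "j \<le> Suc n" for j
  proof (cases "j \<le> n")
    case True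
    have "qpoch p p (Suc n - j) = qpoch p p (n - j) * (1 - z j)"
         "qpoch p p (Suc n + j) = qpoch p p (n + j) * (1 - w * y j)"
      using True by (simp_all add: Suc_diff_le qpoch_Suc z_def w_def y_def power_add)
    moreover have "1 - z j \<noteq> 0" "1 - w * y j \<noteq> 0"
      using True p[of "Suc n - j"] p[of "Suc n + j"]
      by (auto simp: z_def w_def y_def power_add Suc_diff_le mult.assoc)
    ultimately show ?thesis
      using True by (simp add: c_def del: add_Suc)
  next
    case False
    with that have "j = Suc n" by simp
    then show ?thesis by (simp add: z_def)
  qed
  have "(1 + w)\<^sup>2 * (\<Sum>j\<le>Suc n. bailey_coeff p j * c (Suc n) j)
      = (\<Sum>j\<le>Suc n. bailey_coeff p j * (if j \<le> n then c n j else 0))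
        + 4 * w * (\<Sum>j\<le>Suc n. t j * c (Suc n) j)"
    unfolding sum_distrib_left sum.distrib[symmetric]
    by (rule sum.cong) (auto simp: split step)
  also have "(\<Sum>j\<le>Suc n. t j * c (Suc n) j) = 0"
    using even_orthogonality[of p "Suc n"] p by (simp add: t_def c_def del: sum.atMost_Suc)
  also have "(\<Sum>j\<le>Suc n. bailey_coeff p j * (if j \<le> n then c n j else 0))
             = 1 / (qpoch (- p) p n)\<^sup>2"
    using Suc by (simp add: c_def)
  finally have "(1 + w)\<^sup>2 * (\<Sum>j\<le>Suc n. bailey_coeff p j * c (Suc n) j) = 1 / (qpoch (- p) p n)\<^sup>2"
    by simp
  moreover have "qpoch (- p) p (Suc n) = qpoch (- p) p n * (1 + w)"
    by (simp add: qpoch_Suc w_def)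
  ultimately have "1 / (qpoch (- p) p (Suc n))\<^sup>2 = (\<Sum>j\<le>Suc n. bailey_coeff p j * c (Suc n) j)"
    using inverse_square_cancel[OF w] by presburger
  then show ?case
    by (simp add: c_def del: sum.atMost_Suc)
qed

section \<open>Odd case: partial fractions of \<open>1 / (- q;q^2)_(n+1)^2\<close>\<close>

lemma odd_telescope:
  fixes p :: complex
  assumes p: "\<And>i. i > 0 \<Longrightarrow> p ^ i \<noteq> 1" and "m < N"
  shows "(\<Sum>j\<le>m. (- 1) ^ j * p ^ (j choose 2) * (1 - p ^ (2 * j + 1))
             / (qpoch p p (N - j) * qpoch p p (N + j + 1)))
         = (- 1) ^ m * p ^ (Suc m choose 2) * (1 - p ^ Suc m)
             / (qpoch p p (N - Suc m) * qpoch p p (N + m + 1) * (1 - p ^ N))"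
  using \<open>m < N\<close>
proof (induction m)
  case 0
  then obtain d where N: "N = Suc d"
    by (cases N) auto
  show ?case
    using p[of N] N by (simp add: qpoch_Suc numeral_2_eq_2 mult_ac)
next
  case (Suc m)
  then obtain d where N: "N = Suc (Suc m) + d"
    by (metis less_imp_Suc_add add_Suc)
  define a c e u v w P where "a = qpoch p p d" and "c = qpoch p p (N + m + 1)" and "e = p ^ Suc m"
    and "u = 1 - p ^ Suc d" and "v = 1 - p ^ (N + m + 2)" and "w = 1 - p ^ N"
    and "P = (- 1) ^ m * p ^ (Suc m choose 2)"
  have nz: "a \<noteq> 0" "c \<noteq> 0" "u \<noteq> 0" "v \<noteq> 0" "w \<noteq> 0"
    using p[of "Suc d"] p[of "N + m + 2"] p[of N] N
    by (auto simp: a_def c_def u_def v_def w_def qpoch_self_nonzero p)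
  have q: "qpoch p p (N - Suc m) = a * u" "qpoch p p (N + Suc m + 1) = c * v"
          "qpoch p p (N - Suc (Suc m)) = a"
    by (simp_all add: N a_def c_def u_def v_def qpoch_Suc)
  have key: "(1 - e) * v - (1 - e * e * p) * w = - e * (1 - e * p) * u"
    by (simp add: v_def w_def u_def e_def N algebra_simps power_add)
  have IH: "(\<Sum>j\<le>m. (- 1) ^ j * p ^ (j choose 2) * (1 - p ^ (2 * j + 1))
             / (qpoch p p (N - j) * qpoch p p (N + j + 1))) = P * (1 - e) / (a * u * c * w)"
    using Suc by (simp only: q w_def c_def P_def e_def)
  have "p ^ (2 * Suc m + 1) = e * e * p"
    by (simp add: e_def mult_2 power_add)
  then have "(\<Sum>j\<le>Suc m. (- 1) ^ j * p ^ (j choose 2) * (1 - p ^ (2 * j + 1))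
             / (qpoch p p (N - j) * qpoch p p (N + j + 1)))
        = P * (1 - e) / (a * u * c * w) - P * (1 - e * e * p) / (a * u * (c * v))"
    unfolding sum.atMost_Suc IH q by (simp add: P_def)
  also have "\<dots> = P * ((1 - e) * v - (1 - e * e * p) * w) / (a * u * c * v * w)"
    using nz by (simp add: field_simps)
  also have "\<dots> = - P * e * (1 - e * p) / (a * (c * v) * w)"
    unfolding key using nz by (simp add: field_simps)
  also have "\<dots> = (- 1) ^ Suc m * p ^ (Suc (Suc m) choose 2) * (1 - p ^ Suc (Suc m))
             / (qpoch p p (N - Suc (Suc m)) * qpoch p p (N + Suc m + 1) * (1 - p ^ N))"
    unfolding q Suc_choose_two[of "Suc m"] by (simp add: P_def e_def w_def power_add mult_ac)
  finally show ?case .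
qed

text \<open>Here \<open>j\<close> is folded with \<open>- j - 1\<close> in the same bilateral
  family; as in the even case, the last term cancels the telescoped rest.\<close>

lemma odd_orthogonality:
  fixes p :: complex
  assumes p: "\<And>i. i > 0 \<Longrightarrow> p ^ i \<noteq> 1" and "N > 0"
  shows "(\<Sum>j\<le>N. (- 1) ^ j * p ^ (j choose 2) * (1 - p ^ (2 * j + 1))
             / (qpoch p p (N - j) * qpoch p p (N + j + 1))) = 0"
proof -
  obtain m where N: "N = Suc m"
    using \<open>N > 0\<close> by (cases N) auto
  define c w P where "c = qpoch p p (N + m + 1)" and "w = 1 - p ^ N"
    and "P = (- 1) ^ m * p ^ (Suc m choose 2)"
  define v where "v = 1 - p ^ (2 * N + 1)"
  have q: "qpoch p p (N + Suc m + 1) = c * v"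
    by (simp add: c_def N qpoch_Suc v_def mult_2)
  have nz: "c \<noteq> 0" "w \<noteq> 0" "v \<noteq> 0"
    using p[of N] p[of "2 * N + 1"] \<open>N > 0\<close> by (auto simp: c_def w_def v_def qpoch_self_nonzero p)
  have T: "(\<Sum>j\<le>m. (- 1) ^ j * p ^ (j choose 2) * (1 - p ^ (2 * j + 1))
             / (qpoch p p (N - j) * qpoch p p (N + j + 1))) = P * w / (c * w)"
    using odd_telescope[of p m N] p by (simp add: N P_def c_def w_def)
  have "(\<Sum>j\<le>Suc m. (- 1) ^ j * p ^ (j choose 2) * (1 - p ^ (2 * j + 1))
             / (qpoch p p (N - j) * qpoch p p (N + j + 1)))
        = P * w / (c * w) - P * v / (c * v)"
    unfolding sum.atMost_Suc T q by (simp add: N P_def v_def)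
  also have "\<dots> = 0"
    using nz by (simp add: field_simps)
  finally show ?thesis
    by (simp add: N)
qed

text \<open>Same induction as in the even case, with new factor \<open>1 + w\<close>,
  \<open>w = q^(2n+3)\<close>, and \<open>y = q^(2j+1)\<close>. The remainder
  \<open>z (1 + y)^2\<close> meets \<open>(1 - y) / (1 + y)\<close> in the coefficient and becomes
  \<open>z (1 - y^2)\<close>; since \<open>y^2 = p^(2j+1)\<close>, this is the weight of
  \<open>odd_orthogonality\<close>.\<close>

lemma inverse_qpoch_square_odd:
  fixes q :: complex
  assumes q: "\<And>i. i > 0 \<Longrightarrow> q ^ i \<noteq> 1" and q': "\<And>i. i > 0 \<Longrightarrow> q ^ i \<noteq> - 1"
  shows "1 / (qpoch (- q) (q\<^sup>2) (n + 1))\<^sup>2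
         = (\<Sum>j\<le>n. (- 1) ^ j * q ^ (j\<^sup>2 + j) * (1 - q ^ (2 * j + 1)) / (1 + q ^ (2 * j + 1))
              / (qpoch (q\<^sup>2) (q\<^sup>2) (n - j) * qpoch (q\<^sup>2) (q\<^sup>2) (n + j + 1)))"
proof (induction n)
  case 0
  have "1 - q \<noteq> 0" "1 + q \<noteq> 0"
    using q[of 1] q'[of 1] by (auto simp: add_eq_0_iff)
  moreover have "1 - q\<^sup>2 = (1 - q) * (1 + q)"
    by (simp add: power2_eq_square algebra_simps)
  ultimately show ?case
    by (simp add: qpoch_Suc power2_eq_square)
next
  case (Suc n)
  define p where "p = q\<^sup>2"
  have p: "p ^ i \<noteq> 1" if "i > 0" for i
    using q[of "2 * i"] that by (simp add: p_def power_mult)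
  define w where "w = q ^ (2 * n + 3)"
  define c where "c n j = 1 / (qpoch p p (n - j) * qpoch p p (n + j + 1))" for n j
  define t where "t j = (- 1) ^ j * p ^ (j choose 2) * (1 - p ^ (2 * j + 1))" for j
  define y z where "y j = q ^ (2 * j + 1)" and "z j = p ^ (Suc n - j)" for j
  define \<alpha> where "\<alpha> j = (- 1) ^ j * q ^ (j\<^sup>2 + j) * (1 - y j) / (1 + y j)" for j
  have w: "1 + w \<noteq> 0"
    using q'[of "2 * n + 3"] by (simp add: w_def add_eq_0_iff)
  have split: "(1 + w)\<^sup>2 * (\<alpha> j * c (Suc n) j)
      = \<alpha> j * (c (Suc n) j * ((1 - w * y j) * (1 - z j))) + p ^ Suc n * (t j * c (Suc n) j)"
    if "j \<le> Suc n" for j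
  proof -
    have "2 * n + 3 = 2 * (Suc n - j) + (2 * j + 1)"
      using that by simp
    then have wz: "w = z j * y j"
      unfolding w_def z_def y_def p_def by (metis power_add power_mult)
    have y: "1 + y j \<noteq> 0"
      using q'[of "2 * j + 1"] by (simp add: y_def add_eq_0_iff)
    have ch: "j\<^sup>2 + j = 2 * (j choose 2) + 2 * j"
      by (induction j) (simp_all add: Suc_choose_two power2_eq_square)
    \<comment> \<open>This product is free of \<open>j\<close>, so it comes out of the sum before
      orthogonality is applied.\<close>
    have "p ^ Suc n = z j * p ^ j"
      using that by (simp add: z_def flip: power_add power_Suc)
    moreover have "q ^ (j\<^sup>2 + j) = p ^ (j choose 2) * p ^ j"
      unfolding ch p_def by (simp add: power_add power_mult)
    moreover have "p ^ (2 * j + 1) = y j * y j"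
      unfolding y_def p_def by (simp add: algebra_simps flip: power_mult power_add)
    moreover have "(1 + z j * y j)\<^sup>2 * (s * (P * r) * (1 - y j) / (1 + y j) * C)
       = s * (P * r) * (1 - y j) / (1 + y j) * (C * ((1 - z j * y j * y j) * (1 - z j)))
         + z j * r * (s * P * (1 - y j * y j) * C)" for s P r C
      using y by (simp add: divide_simps power2_eq_square) (simp add: algebra_simps)
    ultimately show ?thesis
      unfolding \<alpha>_def t_def wz by (simp only:)
  qed
  have step: "c (Suc n) j * ((1 - w * y j) * (1 - z j)) = (if j \<le> n then c n j else 0)"
    if "j \<le> Suc n" for j
  proof (cases "j \<le> n")
    case True
    have "2 * n + 3 + (2 * j + 1) = 2 * (n + j + 2)"
      by simp
    then have wy: "w * y j = p ^ (n + j + 2)"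
      unfolding w_def y_def p_def by (metis power_add power_mult)
    have "qpoch p p (Suc n - j) = qpoch p p (n - j) * (1 - z j)"
         "qpoch p p (Suc n + j + 1) = qpoch p p (n + j + 1) * (1 - w * y j)"
      using True by (simp_all add: Suc_diff_le qpoch_Suc z_def wy)
    moreover have "1 - z j \<noteq> 0" "1 - w * y j \<noteq> 0"
      using True p[of "Suc n - j"] p[of "n + j + 2"]
      by (auto simp: z_def wy Suc_diff_le)
    ultimately show ?thesis
      using True by (simp add: c_def del: add_Suc add_Suc_right)
  next
    case False
    with that have "j = Suc n" by simp
    then show ?thesis by (simp add: z_def)
  qed
  have "(1 + w)\<^sup>2 * (\<Sum>j\<le>Suc n. \<alpha> j * c (Suc n) j)
      = (\<Sum>j\<le>Suc n. \<alpha> j * (if j \<le> n then c n j else 0))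
        + p ^ Suc n * (\<Sum>j\<le>Suc n. t j * c (Suc n) j)"
    unfolding sum_distrib_left sum.distrib[symmetric]
    by (rule sum.cong) (auto simp: split step)
  also have "(\<Sum>j\<le>Suc n. t j * c (Suc n) j) = 0"
    using odd_orthogonality[of p "Suc n"] p by (simp add: t_def c_def del: sum.atMost_Suc)
  also have "(\<Sum>j\<le>Suc n. \<alpha> j * (if j \<le> n then c n j else 0))
             = 1 / (qpoch (- q) p (n + 1))\<^sup>2"
    using Suc by (simp add: c_def \<alpha>_def y_def p_def mult_ac)
  finally have "(1 + w)\<^sup>2 * (\<Sum>j\<le>Suc n. \<alpha> j * c (Suc n) j) = 1 / (qpoch (- q) p (n + 1))\<^sup>2"
    by simp
  moreover have "qpoch (- q) p (Suc n + 1) = qpoch (- q) p (n + 1) * (1 + w)"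
    by (simp add: qpoch_Suc w_def p_def power_add power_mult power2_eq_square power3_eq_cube power_mult_distrib mult_ac)
  ultimately have "1 / (qpoch (- q) p (Suc n + 1))\<^sup>2 = (\<Sum>j\<le>Suc n. \<alpha> j * c (Suc n) j)"
    using inverse_square_cancel[OF w] by presburger
  then show ?case
    by (simp add: c_def \<alpha>_def y_def p_def del: sum.atMost_Suc)
qed

lemma qpoch_add: "qpoch x q (m + n) = qpoch x q m * qpoch (x * q ^ m) q n"
  by (induction n) (simp_all add: qpoch_Suc power_add mult_ac)

lemma norm_less_1_power_neq:
  fixes q :: "'a :: real_normed_div_algebra"
  assumes "norm q < 1" and "i > 0" and "norm c = 1"
  shows "q ^ i \<noteq> c"
proof
  assume "q ^ i = c"
  then have "norm q ^ i = 1"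
    using assms(3) by (simp flip: norm_power)
  then show False
    using assms power_Suc_less_one[of "norm q" "i - 1"] by (cases "norm q = 0") (auto simp: power_0_left)
qed

section \<open>Infinite products and the summation of \<open>\<^sub>1\<phi>\<^sub>1\<close>\<close>

lemma qpoch_convergent:
  fixes x q :: complex
  assumes "norm q < 1"
  shows "convergent_prod (\<lambda>i. 1 - x * q ^ i)"
proof -
  have "summable (\<lambda>i. norm x * norm q ^ i)"
    using assms by (intro summable_mult summable_geometric) simp
  then have "abs_convergent_prod (\<lambda>i. 1 - x * q ^ i)"
    by (subst abs_convergent_prod_conv_summable) (simp add: norm_mult norm_power)
  then show ?thesis
    by (rule abs_convergent_prod_imp_convergent_prod)
qed

lemma qpoch_LIMSEQ:
  assumes "norm q < 1"
  shows "qpoch x q \<longlonglongrightarrow> qpoch_inf x q"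
proof -
  have "(\<lambda>n. qpoch x q (Suc n)) \<longlonglongrightarrow> qpoch_inf x q"
    using convergent_prod_LIMSEQ[OF qpoch_convergent[OF assms, of x]]
    by (simp add: qpoch_def qpoch_inf_def lessThan_Suc_atMost)
  then show ?thesis
    by (rule filterlim_sequentially_Suc[THEN iffD1])
qed

lemma qpoch_inf_nonzero:
  assumes "norm q < 1" and "\<And>i. x * q ^ i \<noteq> 1"
  shows "qpoch_inf x q \<noteq> 0"
  unfolding qpoch_inf_def using assms by (intro prodinf_nonzero qpoch_convergent) auto

lemma
  assumes "norm q < 1"
  shows qpoch_inf_self_nonzero: "qpoch_inf q q \<noteq> 0"
    and qpoch_inf_minus_self_nonzero: "qpoch_inf (- q) q \<noteq> 0"
    and qpoch_inf_odd_nonzero: "qpoch_inf q (q\<^sup>2) \<noteq> 0"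
proof (safe del: notI intro!: qpoch_inf_nonzero assms)
  fix i
  show "q * q ^ i \<noteq> 1"
    using norm_less_1_power_neq[OF assms, of "Suc i" 1] by simp
  have "q ^ Suc i \<noteq> - 1"
    by (rule norm_less_1_power_neq) (use assms in auto)
  then have "- (q ^ Suc i) \<noteq> 1"
    by (metis minus_minus)
  then show "- q * q ^ i \<noteq> 1"
    by simp
  show "q * (q\<^sup>2) ^ i \<noteq> 1"
    using norm_less_1_power_neq[OF assms, of "Suc (2 * i)" 1] by (simp add: power_mult)
  show "norm (q\<^sup>2) < 1"
    using assms by (simp add: norm_power abs_square_less_1)
qed

lemma qpoch_inf_split:
  assumes "norm q < 1"
  shows "qpoch_inf x q = qpoch x q m * qpoch_inf (x * q ^ m) q"
proof (rule LIMSEQ_unique)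
  show "(\<lambda>n. qpoch x q (n + m)) \<longlonglongrightarrow> qpoch_inf x q"
    by (rule LIMSEQ_ignore_initial_segment) (rule qpoch_LIMSEQ[OF assms])
  show "(\<lambda>n. qpoch x q (n + m)) \<longlonglongrightarrow> qpoch x q m * qpoch_inf (x * q ^ m) q"
    unfolding add.commute[of _ m] qpoch_add by (intro tendsto_intros qpoch_LIMSEQ assms)
qed

lemma qpoch_even_odd: "qpoch q q (2 * n) = qpoch q (q\<^sup>2) n * qpoch (q\<^sup>2) (q\<^sup>2) n"
  by (induction n) (simp_all add: qpoch_Suc power_mult power2_eq_square power_mult_distrib mult_ac)

lemma qpoch_inf_even_odd:
  assumes "norm q < 1"
  shows "qpoch_inf q q = qpoch_inf q (q\<^sup>2) * qpoch_inf (q\<^sup>2) (q\<^sup>2)"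
proof (rule LIMSEQ_unique)
  show "(\<lambda>n. qpoch q q (2 * n)) \<longlonglongrightarrow> qpoch_inf q q"
    using LIMSEQ_subseq_LIMSEQ[OF qpoch_LIMSEQ[OF assms], of "(*) 2"]
    by (simp add: strict_mono_def o_def)
  have "norm (q\<^sup>2) < 1"
    using assms by (simp add: norm_power power_less_one_iff abs_square_less_1)
  then show "(\<lambda>n. qpoch q q (2 * n)) \<longlonglongrightarrow> qpoch_inf q (q\<^sup>2) * qpoch_inf (q\<^sup>2) (q\<^sup>2)"
    unfolding qpoch_even_odd by (intro tendsto_intros qpoch_LIMSEQ)
qed

lemma qpoch_bounded:
  assumes "norm q < 1"
  obtains C where "C > 0" "\<And>n. norm (qpoch x q n) \<le> C"
  using qpoch_LIMSEQ[OF assms, THEN convergentI, THEN convergent_imp_Bseq] by (auto elim!: BseqE)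

lemma inverse_qpoch_bounded:
  assumes "norm q < 1" and "\<And>i. x * q ^ i \<noteq> 1"
  obtains C where "C > 0" "\<And>n. norm (1 / qpoch x q n) \<le> C"
proof -
  have "(\<lambda>n. 1 / qpoch x q n) \<longlonglongrightarrow> 1 / qpoch_inf x q"
    by (intro tendsto_intros qpoch_LIMSEQ qpoch_inf_nonzero assms)
  then show ?thesis
    using that by (auto elim!: BseqE dest!: convergentI convergent_imp_Bseq)
qed

text \<open>The sum \<open>S(z)\<close> satisfies \<open>S(z) = (1 - z) / (1 - a z) S(z Q)\<close> by telescoping, and \<open>S(z Q\<^sup>N)\<close>
  tends to \<open>1\<close>.\<close>

lemma one_phi_one_sum:
  fixes a z Q :: complex
  assumes Q: "norm Q < 1" and z: "norm z < 1" and az: "\<And>i. a * z * Q ^ i \<noteq> 1"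
  shows "(\<lambda>m. qpoch a Q m * (- 1) ^ m * Q ^ (m choose 2) * z ^ m
              / (qpoch Q Q m * qpoch (a * z) Q m))
         sums (qpoch_inf z Q / qpoch_inf (a * z) Q)"
proof -
  define t where "t m z = qpoch a Q m * (- 1) ^ m * Q ^ (m choose 2) * z ^ m
              / (qpoch Q Q m * qpoch (a * z) Q m)" for m z
  define S where "S N = (\<Sum>m. t m (z * Q ^ N))" for N
  have QQ: "Q * Q ^ i \<noteq> 1" for i
    using norm_less_1_power_neq[OF Q, of "Suc i" 1] by simp
  have nz: "qpoch (a * (z * Q ^ N)) Q m \<noteq> 0" "1 - a * (z * Q ^ N) \<noteq> 0" for N m
    using az[of N] az by (auto simp: qpoch_def mult.assoc simp flip: power_add)
  have nz': "qpoch Q Q m \<noteq> 0" for m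
    using QQ by (simp add: qpoch_def)
  obtain A where A: "A > 0" "\<And>n. norm (qpoch a Q n) \<le> A"
    by (rule qpoch_bounded[OF Q]) blast
  obtain D where D: "D > 0" "\<And>n. norm (1 / qpoch Q Q n) \<le> D"
    by (rule inverse_qpoch_bounded[of Q Q]) (use QQ Q in auto)
  obtain B where B: "B > 0" "\<And>n. norm (qpoch (a * z) Q n) \<le> B"
    by (rule qpoch_bounded[OF Q]) blast
  obtain E where E: "E > 0" "\<And>n. norm (1 / qpoch (a * z) Q n) \<le> E"
    by (rule inverse_qpoch_bounded[of Q "a * z"]) (use az Q in auto)
  define M where "M m = A * D * B * E * norm z ^ m" for m
  have M: "summable M"
    unfolding M_def using z by (intro summable_mult summable_geometric) simp
  have bound: "norm (t m (z * Q ^ N)) \<le> M m" for m N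
  proof -
    have "qpoch (a * z) Q N \<noteq> 0"
      using az by (auto simp: qpoch_def)
    \<comment> \<open>Writing the shifted symbol as a quotient of symbols at the fixed point
      \<open>a * z\<close> makes the bound uniform in \<open>N\<close>, as dominated convergence
      requires below.\<close>
    then have eq: "1 / qpoch (a * (z * Q ^ N)) Q m = qpoch (a * z) Q N * (1 / qpoch (a * z) Q (N + m))"
      by (simp add: qpoch_add mult.assoc)
    have "t m (z * Q ^ N) = qpoch a Q m * ((- 1) ^ m * (Q ^ (m choose 2) * Q ^ (N * m))) * (1 / qpoch Q Q m)
        * (1 / qpoch (a * (z * Q ^ N)) Q m) * z ^ m"
      by (simp add: t_def power_mult_distrib mult_ac flip: power_mult)
    then have "t m (z * Q ^ N) = qpoch a Q m * ((- 1) ^ m * (Q ^ (m choose 2) * Q ^ (N * m))) * (1 / qpoch Q Q m)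
        * qpoch (a * z) Q N * (1 / qpoch (a * z) Q (N + m)) * z ^ m"
      unfolding eq by (simp only: mult.assoc)
    also have "norm \<dots> \<le> A * 1 * D * B * E * norm z ^ m"
      unfolding norm_mult[of _ "z ^ m"] norm_mult[of _ "1 / _"] norm_mult[of _ "qpoch _ _ _"]
        norm_mult[of "qpoch _ _ _"] norm_power[of z]
      by (intro mult_mono mult_nonneg_nonneg A D B E)
         (use A(1) B(1) D(1) E(1) Q in \<open>auto simp: norm_mult norm_power mult_le_one power_le_one\<close>)
    finally show ?thesis
      by (simp add: M_def)
  qed
  have summable: "summable (\<lambda>m. t m (z * Q ^ N))" for N
    by (rule summable_comparison_test'[OF M]) (use bound in auto)
  have rec: "S N = (1 - z * Q ^ N) / (1 - a * (z * Q ^ N)) * S (Suc N)" for N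
  proof -
    define y where "y = z * Q ^ N"
    \<comment> \<open>Telescoping certificate: \<open>G\<close> vanishes at \<open>m = 0\<close>
      through \<open>1 - Q^m\<close> and tends to 0 with the terms, so the combination in
      \<open>step\<close> sums to 0.\<close>
    define G where "G m = t m y * (1 - Q ^ m)" for m
    have step: "(1 - y) / (1 - a * y) * t m (y * Q) - t m y = G (Suc m) - G m" for m
    proof -
      define w where "w = Q ^ m"
      define T where "T = qpoch a Q m * (- 1) ^ m * Q ^ (m choose 2) * y ^ m"
      define d where "d = qpoch Q Q m"
      define c where "c = qpoch (a * y) Q m"
      have c: "c \<noteq> 0" "1 - a * y \<noteq> 0" "d \<noteq> 0" "1 - a * y * w \<noteq> 0" "1 - Q * w \<noteq> 0"
        using nz(1)[of N m] nz(2)[of N] nz(1)[of N "Suc m"] nz'[of "Suc m"]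
        by (auto simp: c_def d_def y_def w_def qpoch_Suc mult_ac)
      \<comment> \<open>Splitting off the last factor on one side and the first on the other shows
        how the symbol changes under \<open>y \<mapsto> y Q\<close>.\<close>
      have "qpoch (a * y) Q (m + 1) = qpoch (a * y) Q (1 + m)"
        by simp
      then have "c * (1 - a * y * w) = (1 - a * y) * qpoch (a * y * Q) Q m"
        unfolding qpoch_add c_def w_def by (simp add: qpoch_def)
      then have cQ: "qpoch (a * (y * Q)) Q m = c * (1 - a * y * w) / (1 - a * y)"
        using c by (simp add: field_simps)
      have t: "t m y = T / (d * c)" "t m (y * Q) = T * w * (1 - a * y) / (d * c * (1 - a * y * w))"
        "t (Suc m) y = - T * (1 - a * w) * w * y / (d * (1 - Q * w) * (c * (1 - a * y * w)))"
        unfolding t_def cQ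
        by (simp_all add: T_def d_def c_def w_def qpoch_Suc Suc_choose_two power_add power_mult_distrib mult.assoc)
      have "(1 - y) / (1 - a * y) * (T * w * (1 - a * y) / (d * c * (1 - a * y * w))) - T / (d * c)
          = T / (d * c * (1 - a * y * w)) * ((1 - y) * w - (1 - a * y * w))"
        using c by (simp add: divide_simps) (simp add: algebra_simps)
      also have "(1 - y) * w - (1 - a * y * w) = - (1 - a * w) * w * y - (1 - w) * (1 - a * y * w)"
        by (simp add: algebra_simps)
      also have "T / (d * c * (1 - a * y * w)) * \<dots>
          = - T * (1 - a * w) * w * y / (d * (1 - Q * w) * (c * (1 - a * y * w))) * (1 - Q * w)
            - T / (d * c) * (1 - w)"
        using c by (simp add: divide_simps) (simp add: algebra_simps)
      finally show ?thesis
        unfolding G_def t by (simp add: w_def)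
    qed
    have ty: "summable (\<lambda>m. t m y)" "summable (\<lambda>m. t m (y * Q))"
      using summable[of N] summable[of "Suc N"] by (simp_all add: y_def mult_ac)
    have "(\<lambda>m. t m y * (1 - Q ^ m)) \<longlonglongrightarrow> 0 * (1 - 0)"
      by (intro tendsto_intros summable_LIMSEQ_zero ty LIMSEQ_power_zero Q)
    then have "G \<longlonglongrightarrow> 0"
      by (simp add: G_def[abs_def])
    then have "(\<lambda>m. (1 - y) / (1 - a * y) * t m (y * Q) - t m y) sums 0"
      unfolding step using telescope_sums[OF \<open>G \<longlonglongrightarrow> 0\<close>] by (simp add: G_def)
    moreover have "(\<lambda>m. (1 - y) / (1 - a * y) * t m (y * Q) - t m y)
        sums ((1 - y) / (1 - a * y) * S (Suc N) - S N)"
      using ty unfolding S_def y_def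
      by (intro sums_diff sums_mult) (auto simp: sums_iff mult_ac)
    ultimately show ?thesis
      by (simp add: sums_iff y_def)
  qed
  have "S 0 = qpoch z Q N / qpoch (a * z) Q N * S N" for N
  proof (induction N)
    case (Suc N)
    then show ?case
      unfolding rec[of N] by (simp add: qpoch_Suc mult.assoc)
  qed simp
  moreover have "S \<longlonglongrightarrow> 1"
  proof -
    \<comment> \<open>As \<open>z Q^N\<close> tends to 0, only the term \<open>m = 0\<close>
      survives.\<close>
    have lim: "(\<lambda>N. t m (z * Q ^ N)) \<longlonglongrightarrow> (if m = 0 then 1 else 0)" for m
    proof (cases "m = 0")
      case False
      have "(\<lambda>N. t m (z * Q ^ N)) \<longlonglongrightarrow> qpoch a Q m * (- 1) ^ m * Q ^ (m choose 2) * (z * 0) ^ m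
              / (qpoch Q Q m * (\<Prod>i<m. 1 - a * (z * 0) * Q ^ i))"
        unfolding t_def qpoch_def[of "a * _"]
        by (intro tendsto_intros LIMSEQ_power_zero Q) (use nz' in auto)
      then show ?thesis
        using False by (simp add: power_0_left)
    qed (simp add: t_def binomial_eq_0)
    have "(\<lambda>N. \<Sum>m. t m (z * Q ^ N)) \<longlonglongrightarrow> (\<Sum>m. if m = 0 then 1 else 0)"
      by (rule tannerys_theorem[THEN conjunct2, THEN conjunct2, OF lim always_eventually M])
         (use bound in auto)
    then show ?thesis
      using suminf_finite[of "{0::nat}" "\<lambda>m. if m = 0 then 1 else (0::complex)"] by (simp add: S_def[abs_def])
  qed
  then have "(\<lambda>N. qpoch z Q N / qpoch (a * z) Q N * S N) \<longlonglongrightarrow> qpoch_inf z Q / qpoch_inf (a * z) Q * 1"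
    by (intro tendsto_intros qpoch_LIMSEQ qpoch_inf_nonzero Q az)
  ultimately have "S 0 = qpoch_inf z Q / qpoch_inf (a * z) Q"
    by (simp add: LIMSEQ_const_iff)
  with summable[of 0] show ?thesis
    by (simp add: S_def t_def sums_iff)
qed

section \<open>Inner sums for fixed \<open>j\<close>, and interchange of the summations\<close>

lemma double_choose_two: "2 * (n choose 2) + n = n * n"
  by (induction n) (simp_all add: Suc_choose_two)

text \<open>Divided by its term at \<open>m = 0\<close>, the series is the case
  \<open>a = z = q^(2j+1)\<close>, \<open>Q = q^2\<close> of \<open>one_phi_one_sum\<close>. The
  finite symbols \<open>(q;Q)_j\<close> and \<open>(Q;Q)_(2j)\<close> then complete the shifted
  infinite products.\<close>

lemma bailey_sum_even:
  fixes q :: complex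
  assumes q: "norm q < 1"
  shows "(\<lambda>m. (- 1) ^ (j + m) * q ^ ((j + m)\<^sup>2) * qpoch q (q\<^sup>2) (j + m)
              / (qpoch (q\<^sup>2) (q\<^sup>2) m * qpoch (q\<^sup>2) (q\<^sup>2) (2 * j + m)))
         sums ((- 1) ^ j * q ^ (j\<^sup>2) * qpoch_inf q (q\<^sup>2) / qpoch_inf (q\<^sup>2) (q\<^sup>2))"
proof -
  define Q where "Q = q\<^sup>2"
  have Q: "norm Q < 1"
    using q by (simp add: Q_def norm_power abs_square_less_1)
  define a where "a = q ^ (2 * j + 1)"
  have a: "norm a < 1"
    using q by (simp add: a_def norm_power power_less_one_iff del: power_Suc)
  have aa: "a * a = Q * Q ^ (2 * j)" "a = q * Q ^ j"
    by (simp_all add: a_def Q_def mult_ac flip: power_mult power_add power_Suc)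
  have "a * a * Q ^ i \<noteq> 1" for i
    using norm_less_1_power_neq[OF Q, of "Suc (2 * j + i)" 1] by (simp add: aa(1) power_add mult_ac)
  from one_phi_one_sum[OF Q a this]
  have "(\<lambda>m. (- 1) ^ j * q ^ (j\<^sup>2) * qpoch q Q j / qpoch Q Q (2 * j)
          * (qpoch a Q m * (- 1) ^ m * Q ^ (m choose 2) * a ^ m / (qpoch Q Q m * qpoch (a * a) Q m)))
        sums ((- 1) ^ j * q ^ (j\<^sup>2) * qpoch q Q j / qpoch Q Q (2 * j) * (qpoch_inf a Q / qpoch_inf (a * a) Q))"
    by (rule sums_mult)
  also have "(- 1) ^ j * q ^ (j\<^sup>2) * qpoch q Q j / qpoch Q Q (2 * j) * (qpoch_inf a Q / qpoch_inf (a * a) Q)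
      = (- 1) ^ j * q ^ (j\<^sup>2) * qpoch_inf q Q / qpoch_inf Q Q"
    unfolding qpoch_inf_split[OF Q, of q j] qpoch_inf_split[OF Q, of Q "2 * j"]
    by (simp flip: aa)
  also have "(\<lambda>m. (- 1) ^ j * q ^ (j\<^sup>2) * qpoch q Q j / qpoch Q Q (2 * j)
          * (qpoch a Q m * (- 1) ^ m * Q ^ (m choose 2) * a ^ m / (qpoch Q Q m * qpoch (a * a) Q m)))
      = (\<lambda>m. (- 1) ^ (j + m) * q ^ ((j + m)\<^sup>2) * qpoch q Q (j + m) / (qpoch Q Q m * qpoch Q Q (2 * j + m)))"
  proof
    fix m
    have "(j + m)\<^sup>2 = j\<^sup>2 + 2 * (m choose 2) + (2 * j + 1) * m"
      using double_choose_two[of m] by (simp add: power2_eq_square algebra_simps)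
    then have "q ^ ((j + m)\<^sup>2) = q ^ (j\<^sup>2) * Q ^ (m choose 2) * a ^ m"
      by (simp only: a_def Q_def power_add power_mult)
    then show "(- 1) ^ j * q ^ (j\<^sup>2) * qpoch q Q j / qpoch Q Q (2 * j)
          * (qpoch a Q m * (- 1) ^ m * Q ^ (m choose 2) * a ^ m / (qpoch Q Q m * qpoch (a * a) Q m))
      = (- 1) ^ (j + m) * q ^ ((j + m)\<^sup>2) * qpoch q Q (j + m) / (qpoch Q Q m * qpoch Q Q (2 * j + m))"
      unfolding qpoch_add[of _ _ j] qpoch_add[of _ _ "2 * j"] aa[symmetric]
      by (simp add: power_add mult_ac)
  qed
  finally show ?thesis
    by (simp add: Q_def)
qed

text \<open>Now \<open>a = q^(2j+1)\<close> but \<open>z = a Q\<close>, so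
  \<open>(z;Q)_\<infinity>\<close> misses the factor \<open>1 - a\<close>. The resulting denominator
  cancels the numerator \<open>1 - q^(2j+1)\<close> of the odd partial fraction
  coefficients.\<close>

lemma bailey_sum_odd:
  fixes q :: complex
  assumes q: "norm q < 1"
  shows "(\<lambda>m. (- 1) ^ (j + m) * q ^ ((j + m + 1)\<^sup>2) * qpoch q (q\<^sup>2) (j + m)
              / (qpoch (q\<^sup>2) (q\<^sup>2) m * qpoch (q\<^sup>2) (q\<^sup>2) (2 * j + m + 1)))
         sums ((- 1) ^ j * q ^ ((j + 1)\<^sup>2) * qpoch_inf q (q\<^sup>2)
               / (qpoch_inf (q\<^sup>2) (q\<^sup>2) * (1 - q ^ (2 * j + 1))))"
proof -
  define Q where "Q = q\<^sup>2"
  have Q: "norm Q < 1"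
    using q by (simp add: Q_def norm_power abs_square_less_1)
  define a where "a = q ^ (2 * j + 1)"
  define z where "z = q ^ (2 * j + 3)"
  have z: "norm z < 1"
    using q by (simp add: z_def norm_power power_less_one_iff)
  have aa: "a = q * Q ^ j" "z = q * Q ^ Suc j"
    by (simp_all add: a_def z_def Q_def numeral_3_eq_3 mult_ac flip: power_mult power_add power_Suc)
  have az: "a * z = Q * Q ^ (2 * j + 1)"
    by (simp add: aa power_add power_mult power_mult_distrib Q_def power2_eq_square mult_ac)
  have "a * z * Q ^ i \<noteq> 1" for i
    using norm_less_1_power_neq[OF Q, of "Suc (2 * j + 1 + i)" 1] by (simp add: az power_add mult_ac)
  from one_phi_one_sum[OF Q z this]
  have "(\<lambda>m. (- 1) ^ j * q ^ ((j + 1)\<^sup>2) * qpoch q Q j / qpoch Q Q (2 * j + 1)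
          * (qpoch a Q m * (- 1) ^ m * Q ^ (m choose 2) * z ^ m / (qpoch Q Q m * qpoch (a * z) Q m)))
        sums ((- 1) ^ j * q ^ ((j + 1)\<^sup>2) * qpoch q Q j / qpoch Q Q (2 * j + 1)
              * (qpoch_inf z Q / qpoch_inf (a * z) Q))"
    by (rule sums_mult)
  also have "(- 1) ^ j * q ^ ((j + 1)\<^sup>2) * qpoch q Q j / qpoch Q Q (2 * j + 1)
              * (qpoch_inf z Q / qpoch_inf (a * z) Q)
      = (- 1) ^ j * q ^ ((j + 1)\<^sup>2) * qpoch_inf q Q / (qpoch_inf Q Q * (1 - a))"
  proof -
    have "1 - a \<noteq> 0"
      using norm_less_1_power_neq[OF q, of "2 * j + 1" 1] by (simp add: a_def)
    then show ?thesis
      unfolding qpoch_inf_split[OF Q, of q "Suc j"] qpoch_inf_split[OF Q, of Q "2 * j + 1"]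
        az[symmetric] aa(2)[symmetric] qpoch_Suc[of q] aa(1)[symmetric]
      by simp
  qed
  also have "(\<lambda>m. (- 1) ^ j * q ^ ((j + 1)\<^sup>2) * qpoch q Q j / qpoch Q Q (2 * j + 1)
          * (qpoch a Q m * (- 1) ^ m * Q ^ (m choose 2) * z ^ m / (qpoch Q Q m * qpoch (a * z) Q m)))
      = (\<lambda>m. (- 1) ^ (j + m) * q ^ ((j + m + 1)\<^sup>2) * qpoch q Q (j + m)
              / (qpoch Q Q m * qpoch Q Q (2 * j + 1 + m)))"
  proof
    fix m
    have "(j + m + 1)\<^sup>2 = (j + 1)\<^sup>2 + 2 * (m choose 2) + (2 * j + 3) * m"
      using double_choose_two[of m] by (simp add: power2_eq_square algebra_simps)
    then have "q ^ ((j + m + 1)\<^sup>2) = q ^ ((j + 1)\<^sup>2) * Q ^ (m choose 2) * z ^ m"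
      by (simp only: z_def Q_def power_add power_mult)
    then show "(- 1) ^ j * q ^ ((j + 1)\<^sup>2) * qpoch q Q j / qpoch Q Q (2 * j + 1)
          * (qpoch a Q m * (- 1) ^ m * Q ^ (m choose 2) * z ^ m / (qpoch Q Q m * qpoch (a * z) Q m))
      = (- 1) ^ (j + m) * q ^ ((j + m + 1)\<^sup>2) * qpoch q Q (j + m)
              / (qpoch Q Q m * qpoch Q Q (2 * j + 1 + m))"
      unfolding qpoch_add[of _ _ j] qpoch_add[of _ _ "2 * j + 1"] aa(1)[symmetric] az[symmetric]
      by (simp add: power_add mult_ac)
  qed
  finally show ?thesis
    by (simp add: Q_def a_def)
qed

text \<open>Fubini for a geometrically dominated double series: the antidiagonal sums arise when the
  \<open>n\<close>-th summand is expanded in partial fractions, the row sums when \<open>j\<close>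
  is fixed and \<open>m = n - j\<close> runs.\<close>

lemma triangular_sums:
  fixes f :: "nat \<Rightarrow> nat \<Rightarrow> complex"
  assumes bound: "\<And>j m. norm (f j m) \<le> C * r ^ j * r ^ m" and r: "0 \<le> r" "r < 1"
    and g: "\<And>j. f j sums g j"
  shows "summable g" and "(\<lambda>n. \<Sum>j\<le>n. f j (n - j)) sums suminf g"
proof -
  define F where "F = (\<lambda>(j, m). f j m)"
  have geo: "((\<lambda>m. r ^ m) has_sum (1 / (1 - r))) UNIV"
    using r by (intro sums_nonneg_imp_has_sum geometric_sums) auto
  have "(\<lambda>(j, m). C * r ^ j * r ^ m) summable_on UNIV \<times> UNIV"
  proof (rule summable_on_SigmaI)
    show "((\<lambda>m. case (j, m) of (j, m) \<Rightarrow> C * r ^ j * r ^ m) has_sum C * r ^ j * (1 / (1 - r))) UNIV" for j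
      using has_sum_cmult_right[OF geo] by simp
    show "(\<lambda>j. C * r ^ j * (1 / (1 - r))) summable_on UNIV"
      using geo by (intro summable_on_cmult_left summable_on_cmult_right) (auto simp: summable_on_def)
    show "0 \<le> (case (j, m) of (j, m) \<Rightarrow> C * r ^ j * r ^ m)" for j m
      using order_trans[OF norm_ge_zero bound] by simp
  qed
  then have "(\<lambda>x. norm (F x)) summable_on UNIV \<times> UNIV"
    by (rule summable_on_comparison_test) (use bound in \<open>auto simp: F_def\<close>)
  then have "F summable_on UNIV \<times> UNIV"
    by (rule abs_summable_summable)
  then obtain S where S: "(F has_sum S) (UNIV \<times> UNIV)"
    by (auto simp: summable_on_def)
  have "((\<lambda>m. F (j, m)) has_sum g j) UNIV" for j
  proof (rule norm_summable_imp_has_sum)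
    show "summable (\<lambda>m. norm (F (j, m)))"
      by (rule summable_comparison_test'[of "\<lambda>m. C * r ^ j * r ^ m"])
         (use bound r in \<open>auto simp: F_def intro!: summable_mult summable_geometric\<close>)
    show "(\<lambda>m. F (j, m)) sums g j"
      using g by (simp add: F_def)
  qed
  then have "(g has_sum S) UNIV"
    by (rule has_sum_SigmaD[OF S])
  then have gS: "g sums S"
    by (rule has_sum_imp_sums)
  then show "summable g"
    by (simp add: sums_iff)
  have "((\<lambda>(n, j). f j (n - j)) has_sum S) (SIGMA n:UNIV. {..n})"
    using S
    by (subst has_sum_reindex_bij_witness[where i = "\<lambda>(j, m). (j + m, j)" and j = "\<lambda>(n, j). (j, n - j)"
          and T = "UNIV \<times> UNIV" and h = F and s' = S]) (auto simp: F_def)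
  then have "((\<lambda>n. \<Sum>j\<le>n. f j (n - j)) has_sum S) UNIV"
    by (rule has_sum_SigmaD) simp
  then show "(\<lambda>n. \<Sum>j\<le>n. f j (n - j)) sums suminf g"
    using gS by (auto dest: has_sum_imp_sums simp: sums_iff)
qed

section \<open>The mock theta function \<open>\<mu>\<close>\<close>

lemma norm_one_plus_power_ge:
  fixes q :: complex
  assumes "norm q < 1" and "j > 0"
  shows "norm (1 + q ^ j) \<ge> 1 - norm q"
proof -
  have "norm q ^ j \<le> norm q ^ 1"
    using assms by (intro power_decreasing) auto
  moreover have "1 - norm (q ^ j) \<le> norm (1 + q ^ j)"
    using norm_triangle_ineq2[of 1 "- (q ^ j)"] by simp
  ultimately show ?thesis
    by (simp add: norm_power)
qed

lemma norm_bailey_coeff_le: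
  assumes p: "norm p < 1"
  shows "norm (bailey_coeff p j) \<le> 4 / (1 - norm p) * norm p ^ j"
proof (cases "j = 0")
  case True
  then show ?thesis
    using p norm_ge_zero[of p] by (simp add: bailey_coeff_def pos_le_divide_eq del: norm_ge_zero)
next
  case False
  have "j \<le> (Suc j choose 2)"
    by (simp add: Suc_choose_two)
  then have "norm p ^ (Suc j choose 2) \<le> norm p ^ j"
    using p by (intro power_decreasing) auto
  then have "4 * norm p ^ (Suc j choose 2) / norm (1 + p ^ j) \<le> 4 * norm p ^ j / (1 - norm p)"
    using norm_one_plus_power_ge[OF p, of j] False p by (intro frac_le) auto
  then show ?thesis
    using False by (simp add: bailey_coeff_def norm_divide norm_mult norm_power)
qed

text \<open>\<open>inverse_qpoch_square_even\<close> in base \<open>q^2\<close> expands each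
  summand; after the interchange \<open>bailey_sum_even\<close> evaluates the inner sums.\<close>

lemma mu_series_sums:
  assumes q: "norm q < 1"
  shows "summable (\<lambda>j. qpoch_inf q (q\<^sup>2) / qpoch_inf (q\<^sup>2) (q\<^sup>2) * bailey_coeff q (2 * j))"
    and "(\<lambda>n. (- 1) ^ n * q ^ (n\<^sup>2) * qpoch q (q\<^sup>2) n / (qpoch (- (q\<^sup>2)) (q\<^sup>2) n)\<^sup>2)
         sums (\<Sum>j. qpoch_inf q (q\<^sup>2) / qpoch_inf (q\<^sup>2) (q\<^sup>2) * bailey_coeff q (2 * j))"
proof -
  define Q where "Q = q\<^sup>2"
  have Q: "norm Q < 1"
    using q by (simp add: Q_def norm_power abs_square_less_1)
  obtain A where A: "A > 0" "\<And>n. norm (qpoch q Q n) \<le> A"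
    by (rule qpoch_bounded[OF Q]) blast
  obtain D where D: "D > 0" "\<And>n. norm (1 / qpoch Q Q n) \<le> D"
    using inverse_qpoch_bounded[of Q Q] norm_less_1_power_neq[OF Q, of "Suc _" 1] Q by auto
  define h where "h j m = (- 1) ^ (j + m) * q ^ ((j + m)\<^sup>2) * qpoch q Q (j + m)
                          / (qpoch Q Q m * qpoch Q Q (2 * j + m))" for j m
  define f where "f j m = bailey_coeff Q j * h j m" for j m
  define C where "C = 4 / (1 - norm Q) * (A * D * D)"
  define g where "g j = qpoch_inf q Q / qpoch_inf Q Q * bailey_coeff q (2 * j)" for j
  have "norm (f j m) \<le> C * norm q ^ j * norm q ^ m" for j m
  proof -
    \<comment> \<open>All the decay in \<open>j\<close> and \<open>m\<close> is taken from
      \<open>q^((j+m)^2)\<close>; the other factors only need to be bounded.\<close>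
    have "j + m \<le> (j + m)\<^sup>2"
      by (simp add: power2_eq_square)
    then have "norm q ^ ((j + m)\<^sup>2) \<le> norm q ^ (j + m)"
      using q by (intro power_decreasing) auto
    then have 1: "norm ((- 1) ^ (j + m) * q ^ ((j + m)\<^sup>2)) \<le> norm q ^ (j + m)"
      by (simp add: norm_mult norm_power)
    have "h j m = ((- 1) ^ (j + m) * q ^ ((j + m)\<^sup>2)) * (qpoch q Q (j + m) * (1 / qpoch Q Q m)
        * (1 / qpoch Q Q (2 * j + m)))"
      by (simp add: h_def)
    also have "norm \<dots> \<le> norm q ^ (j + m) * (A * D * D)"
      unfolding norm_mult[of "_ * q ^ _"] norm_mult[of _ "1 / _"] norm_mult[of "qpoch _ _ _"]
      by (intro mult_mono mult_nonneg_nonneg 1 A D) (use A(1) D(1) in auto)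
    finally have 2: "norm (h j m) \<le> norm q ^ (j + m) * (A * D * D)" .
    have "norm Q ^ j \<le> 1"
      using Q by (intro power_le_one) auto
    then have "4 / (1 - norm Q) * norm Q ^ j \<le> 4 / (1 - norm Q) * 1"
      using Q by (intro mult_left_mono) auto
    then have "norm (bailey_coeff Q j) \<le> 4 / (1 - norm Q)"
      using norm_bailey_coeff_le[OF Q, of j] by simp
    then have "norm (f j m) \<le> 4 / (1 - norm Q) * (norm q ^ (j + m) * (A * D * D))"
      unfolding f_def norm_mult using 2 Q by (intro mult_mono) auto
    then show ?thesis
      by (simp add: C_def power_add mult_ac)
  qed
  moreover have "f j sums g j" for j
  proof -
    have "f j sums (bailey_coeff Q j * ((- 1) ^ j * q ^ (j\<^sup>2) * qpoch_inf q Q / qpoch_inf Q Q))"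
      using bailey_sum_even[OF q, of j] unfolding f_def h_def Q_def by (rule sums_mult)
    also have "bailey_coeff Q j * ((- 1) ^ j * q ^ (j\<^sup>2) * qpoch_inf q Q / qpoch_inf Q Q) = g j"
    proof (cases "j = 0")
      case False
      \<comment> \<open>This exponent identity turns the coefficient of index \<open>j\<close> in
        base \<open>q^2\<close>, times \<open>q^(j^2)\<close>, into the coefficient of index
        \<open>2j\<close> in base \<open>q\<close>.\<close>
      have "(Suc (2 * j) choose 2) = 2 * (Suc j choose 2) + j\<^sup>2"
        using double_choose_two[of "2 * j"] double_choose_two[of j]
        by (simp add: Suc_choose_two power2_eq_square)
      then have "q ^ (Suc (2 * j) choose 2) = Q ^ (Suc j choose 2) * q ^ (j\<^sup>2)"
        by (simp only: power_add power_mult Q_def)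
      moreover have "q ^ (2 * j) = Q ^ j" "((- 1) ^ j * (- 1) ^ j :: complex) = 1"
        by (simp_all add: Q_def power_mult flip: power_add)
      ultimately have "bailey_coeff q (2 * j) = bailey_coeff Q j * ((- 1) ^ j * q ^ (j\<^sup>2))"
        using False by (simp add: bailey_coeff_def)
      then show ?thesis
        by (simp add: g_def)
    qed (simp add: g_def bailey_coeff_def)
    finally show ?thesis .
  qed
  ultimately have T: "summable g" "(\<lambda>n. \<Sum>j\<le>n. f j (n - j)) sums suminf g"
    using triangular_sums[of f C "norm q" g] q by simp_all
  have "(\<Sum>j\<le>n. f j (n - j)) = (- 1) ^ n * q ^ (n\<^sup>2) * qpoch q Q n / (qpoch (- Q) Q n)\<^sup>2" for n
  proof -
    have "(\<Sum>j\<le>n. f j (n - j))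
        = (\<Sum>j\<le>n. (- 1) ^ n * q ^ (n\<^sup>2) * qpoch q Q n * (bailey_coeff Q j / (qpoch Q Q (n - j) * qpoch Q Q (n + j))))"
      by (rule sum.cong) (auto simp: f_def h_def add.commute mult_2)
    also have "\<dots> = (- 1) ^ n * q ^ (n\<^sup>2) * qpoch q Q n * (1 / (qpoch (- Q) Q n)\<^sup>2)"
      unfolding sum_distrib_left[symmetric]
      by (subst inverse_qpoch_square_even) (use Q in \<open>simp_all add: norm_less_1_power_neq\<close>)
    finally show ?thesis
      by simp
  qed
  then show "summable (\<lambda>j. qpoch_inf q (q\<^sup>2) / qpoch_inf (q\<^sup>2) (q\<^sup>2) * bailey_coeff q (2 * j))"
    and "(\<lambda>n. (- 1) ^ n * q ^ (n\<^sup>2) * qpoch q (q\<^sup>2) n / (qpoch (- (q\<^sup>2)) (q\<^sup>2) n)\<^sup>2)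
         sums (\<Sum>j. qpoch_inf q (q\<^sup>2) / qpoch_inf (q\<^sup>2) (q\<^sup>2) * bailey_coeff q (2 * j))"
    using T by (simp_all add: g_def[abs_def] Q_def)
qed

text \<open>The odd counterpart, from \<open>inverse_qpoch_square_odd\<close> and
  \<open>bailey_sum_odd\<close>. The factor \<open>- 1 / 4\<close> undoes the 4 and the sign
  \<open>(- 1)^(2j+1)\<close> built into \<open>bailey_coeff\<close>.\<close>

lemma S1_series_sums:
  assumes q: "norm q < 1"
  shows "summable (\<lambda>j. - (1 / 4) * (qpoch_inf q (q\<^sup>2) / qpoch_inf (q\<^sup>2) (q\<^sup>2) * bailey_coeff q (2 * j + 1)))"
    and "(\<lambda>n. qpoch q (q\<^sup>2) n * (- 1) ^ n * q ^ ((n + 1)\<^sup>2) / (qpoch (- q) (q\<^sup>2) (n + 1))\<^sup>2)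
         sums (\<Sum>j. - (1 / 4) * (qpoch_inf q (q\<^sup>2) / qpoch_inf (q\<^sup>2) (q\<^sup>2) * bailey_coeff q (2 * j + 1)))"
proof -
  define Q where "Q = q\<^sup>2"
  have Q: "norm Q < 1"
    using q by (simp add: Q_def norm_power abs_square_less_1)
  obtain A where A: "A > 0" "\<And>n. norm (qpoch q Q n) \<le> A"
    by (rule qpoch_bounded[OF Q]) blast
  obtain D where D: "D > 0" "\<And>n. norm (1 / qpoch Q Q n) \<le> D"
    using inverse_qpoch_bounded[of Q Q] norm_less_1_power_neq[OF Q, of "Suc _" 1] Q by auto
  define \<alpha> where "\<alpha> j = (- 1) ^ j * q ^ (j\<^sup>2 + j) * (1 - q ^ (2 * j + 1)) / (1 + q ^ (2 * j + 1))" for j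
  define h where "h j m = (- 1) ^ (j + m) * q ^ ((j + m + 1)\<^sup>2) * qpoch q Q (j + m)
                          / (qpoch Q Q m * qpoch Q Q (2 * j + m + 1))" for j m
  define f where "f j m = \<alpha> j * h j m" for j m
  define C where "C = 2 / (1 - norm q) * (A * D * D)"
  define g where "g j = - (1 / 4) * (qpoch_inf q Q / qpoch_inf Q Q * bailey_coeff q (2 * j + 1))" for j
  have "norm (f j m) \<le> C * norm q ^ j * norm q ^ m" for j m
  proof -
    have "j + m \<le> (j + m + 1)\<^sup>2"
      by (simp add: power2_eq_square)
    then have "norm q ^ ((j + m + 1)\<^sup>2) \<le> norm q ^ (j + m)"
      using q by (intro power_decreasing) auto
    then have 1: "norm ((- 1) ^ (j + m) * q ^ ((j + m + 1)\<^sup>2)) \<le> norm q ^ (j + m)"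
      by (simp add: norm_mult norm_power)
    have "h j m = ((- 1) ^ (j + m) * q ^ ((j + m + 1)\<^sup>2)) * (qpoch q Q (j + m) * (1 / qpoch Q Q m)
        * (1 / qpoch Q Q (2 * j + m + 1)))"
      by (simp add: h_def)
    also have "norm \<dots> \<le> norm q ^ (j + m) * (A * D * D)"
      unfolding norm_mult[of "_ * q ^ _"] norm_mult[of _ "1 / _"] norm_mult[of "qpoch _ _ _"]
      by (intro mult_mono mult_nonneg_nonneg 1 A D) (use A(1) D(1) in auto)
    finally have 2: "norm (h j m) \<le> norm q ^ (j + m) * (A * D * D)" .
    have le1: "norm (q ^ n) \<le> 1" for n
      using q by (simp add: norm_power power_le_one)
    have "norm (1 - q ^ (2 * j + 1)) \<le> 2"
      using norm_triangle_ineq4[of 1 "q ^ (2 * j + 1)"] le1[of "2 * j + 1"] by simp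
    then have "norm (q ^ (j\<^sup>2 + j)) * norm (1 - q ^ (2 * j + 1)) / norm (1 + q ^ (2 * j + 1))
        \<le> 1 * 2 / (1 - norm q)"
      using le1[of "j\<^sup>2 + j"] norm_one_plus_power_ge[OF q, of "2 * j + 1"] q
      by (intro frac_le mult_mono) auto
    then have "norm (\<alpha> j) \<le> 2 / (1 - norm q)"
      by (simp add: \<alpha>_def norm_mult norm_divide norm_power)
    then have "norm (f j m) \<le> 2 / (1 - norm q) * (norm q ^ (j + m) * (A * D * D))"
      unfolding f_def norm_mult using 2 q by (intro mult_mono) auto
    then show ?thesis
      by (simp add: C_def power_add mult_ac)
  qed
  moreover have "f j sums g j" for j
  proof -
    have "f j sums (\<alpha> j * ((- 1) ^ j * q ^ ((j + 1)\<^sup>2) * qpoch_inf q Q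
               / (qpoch_inf Q Q * (1 - q ^ (2 * j + 1)))))"
      using bailey_sum_odd[OF q, of j] unfolding f_def h_def Q_def by (rule sums_mult)
    also have "\<alpha> j * ((- 1) ^ j * q ^ ((j + 1)\<^sup>2) * qpoch_inf q Q
               / (qpoch_inf Q Q * (1 - q ^ (2 * j + 1)))) = g j"
    proof -
      have "(Suc (2 * j + 1) choose 2) = j\<^sup>2 + j + (j + 1)\<^sup>2"
        using double_choose_two[of "2 * j"]
        by (simp add: Suc_choose_two power2_eq_square)
      then have e: "q ^ (Suc (2 * j + 1) choose 2) = q ^ (j\<^sup>2 + j) * q ^ ((j + 1)\<^sup>2)"
        by (simp only: power_add)
      have "1 - q ^ (2 * j + 1) \<noteq> 0"
        using norm_less_1_power_neq[OF q, of "2 * j + 1" 1] by simp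
      then have "\<alpha> j * ((- 1) ^ j * q ^ ((j + 1)\<^sup>2) * qpoch_inf q Q
               / (qpoch_inf Q Q * (1 - q ^ (2 * j + 1))))
          = ((- 1) ^ j * (- 1) ^ j) * (q ^ (j\<^sup>2 + j) * q ^ ((j + 1)\<^sup>2)) * qpoch_inf q Q
               / (qpoch_inf Q Q * (1 + q ^ (2 * j + 1)))"
        unfolding \<alpha>_def by (simp add: mult_ac)
      moreover have "bailey_coeff q (2 * j + 1)
          = - (4 * (q ^ (j\<^sup>2 + j) * q ^ ((j + 1)\<^sup>2)) / (1 + q ^ (2 * j + 1)))"
        unfolding bailey_coeff_def e by simp
      ultimately show ?thesis
        by (simp add: g_def mult_ac flip: power_add del: power_Suc)
    qed
    finally show ?thesis .
  qed
  ultimately have T: "summable g" "(\<lambda>n. \<Sum>j\<le>n. f j (n - j)) sums suminf g"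
    using triangular_sums[of f C "norm q" g] q by simp_all
  have "(\<Sum>j\<le>n. f j (n - j))
      = qpoch q Q n * (- 1) ^ n * q ^ ((n + 1)\<^sup>2) / (qpoch (- q) Q (n + 1))\<^sup>2" for n
  proof -
    have "(\<Sum>j\<le>n. f j (n - j))
        = (\<Sum>j\<le>n. qpoch q Q n * (- 1) ^ n * q ^ ((n + 1)\<^sup>2)
            * (\<alpha> j / (qpoch Q Q (n - j) * qpoch Q Q (n + j + 1))))"
      by (rule sum.cong) (auto simp: f_def h_def add.commute mult_2)
    also have "\<dots> = qpoch q Q n * (- 1) ^ n * q ^ ((n + 1)\<^sup>2) * (1 / (qpoch (- q) Q (n + 1))\<^sup>2)"
      unfolding sum_distrib_left[symmetric] Q_def \<alpha>_def
      by (subst inverse_qpoch_square_odd) (use q in \<open>simp_all add: norm_less_1_power_neq\<close>)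
    finally show ?thesis
      by simp
  qed
  then show "summable (\<lambda>j. - (1 / 4) * (qpoch_inf q (q\<^sup>2) / qpoch_inf (q\<^sup>2) (q\<^sup>2) * bailey_coeff q (2 * j + 1)))"
    and "(\<lambda>n. qpoch q (q\<^sup>2) n * (- 1) ^ n * q ^ ((n + 1)\<^sup>2) / (qpoch (- q) (q\<^sup>2) (n + 1))\<^sup>2)
         sums (\<Sum>j. - (1 / 4) * (qpoch_inf q (q\<^sup>2) / qpoch_inf (q\<^sup>2) (q\<^sup>2) * bailey_coeff q (2 * j + 1)))"
    using T by (simp_all add: g_def[abs_def] Q_def)
qed

text \<open>Limit \<open>n \<rightarrow> \<infinity>\<close> of
  \<open>inverse_qpoch_square_even\<close> with \<open>p = q\<close>: both symbols in each
  denominator tend to \<open>(q;q)_\<infinity>\<close>.\<close>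

lemma bailey_coeff_sums:
  assumes q: "norm q < 1"
  shows "bailey_coeff q sums ((qpoch_inf q q)\<^sup>2 / (qpoch_inf (- q) q)\<^sup>2)"
proof -
  define P where "P = qpoch_inf q q"
  \<comment> \<open>Extension by zero beyond \<open>j = n\<close> turns the finite sums into series
    over a fixed index set, to which Tannery's theorem applies.\<close>
  define a where "a j n = (if j \<le> n then bailey_coeff q j / (qpoch q q (n - j) * qpoch q q (n + j)) else 0)"
    for j n
  obtain D where D: "D > 0" "\<And>n. norm (1 / qpoch q q n) \<le> D"
    using inverse_qpoch_bounded[of q q] norm_less_1_power_neq[OF q, of "Suc _" 1] q by auto
  have P: "P \<noteq> 0" "qpoch_inf (- q) q \<noteq> 0"
    unfolding P_def by (rule qpoch_inf_self_nonzero qpoch_inf_minus_self_nonzero; fact q)+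
  define M where "M j = 4 / (1 - norm q) * norm q ^ j * (D * D)" for j
  have M: "summable M"
    unfolding M_def using q by (intro summable_mult2 summable_mult summable_geometric) auto
  have bound: "norm (a j n) \<le> M j" for j n
  proof (cases "j \<le> n")
    case True
    have "a j n = bailey_coeff q j * ((1 / qpoch q q (n - j)) * (1 / qpoch q q (n + j)))"
      using True by (simp add: a_def)
    also have "norm \<dots> \<le> M j"
      unfolding M_def norm_mult using D(1) q
      by (intro mult_mono norm_bailey_coeff_le D q mult_nonneg_nonneg) auto
    finally show ?thesis .
  next
    case False
    then show ?thesis
      using q D by (simp add: a_def M_def)
  qed
  have lim: "(\<lambda>n. a j n) \<longlonglongrightarrow> bailey_coeff q j / (P * P)" for j
  proof (rule LIMSEQ_offset)
    have "(\<lambda>n. bailey_coeff q j / (qpoch q q n * qpoch q q (n + 2 * j))) \<longlonglongrightarrow> bailey_coeff q j / (P * P)"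
      unfolding P_def
      by (intro tendsto_intros qpoch_LIMSEQ[OF q] LIMSEQ_ignore_initial_segment[OF qpoch_LIMSEQ[OF q]])
         (use P in \<open>auto simp: P_def\<close>)
    then show "(\<lambda>n. a j (n + j)) \<longlonglongrightarrow> bailey_coeff q j / (P * P)"
      by (simp add: a_def mult_2 add.assoc)
  qed
  have "\<forall>\<^sub>F (j, n) in at_top \<times>\<^sub>F at_top. norm (a j n) \<le> M j"
    by (rule always_eventually) (auto simp: bound)
  then have T: "summable (\<lambda>j. norm (bailey_coeff q j / (P * P)))"
      "(\<lambda>n. \<Sum>j. a j n) \<longlonglongrightarrow> (\<Sum>j. bailey_coeff q j / (P * P))"
    using tannerys_theorem[where a = a and F = sequentially, OF lim _ M] by auto
  have "(\<Sum>j. a j n) = 1 / (qpoch (- q) q n)\<^sup>2" for n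
  proof -
    have "(\<Sum>j. a j n) = (\<Sum>j\<le>n. a j n)"
      by (rule suminf_finite) (auto simp: a_def)
    also have "\<dots> = 1 / (qpoch (- q) q n)\<^sup>2"
      by (subst inverse_qpoch_square_even) (use q in \<open>simp_all add: norm_less_1_power_neq a_def\<close>)
    finally show ?thesis .
  qed
  moreover have "(\<lambda>n. 1 / (qpoch (- q) q n)\<^sup>2) \<longlonglongrightarrow> 1 / (qpoch_inf (- q) q)\<^sup>2"
    by (intro tendsto_intros qpoch_LIMSEQ q) (use P in simp)
  ultimately have "(\<Sum>j. bailey_coeff q j / (P * P)) = 1 / (qpoch_inf (- q) q)\<^sup>2"
    using T(2) LIMSEQ_unique by auto
  with T(1) have "(\<lambda>j. bailey_coeff q j / (P * P)) sums (1 / (qpoch_inf (- q) q)\<^sup>2)"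
    by (auto dest: summable_norm_cancel simp: sums_iff)
  then have "(\<lambda>j. P * P * (bailey_coeff q j / (P * P))) sums (P * P * (1 / (qpoch_inf (- q) q)\<^sup>2))"
    by (rule sums_mult)
  then show ?thesis
    using P by (simp add: P_def power2_eq_square)
qed

text \<open>With \<open>c = (q;q^2)_\<infinity> / (q^2;q^2)_\<infinity>\<close>, the even-indexed
  part of \<open>c * bailey_coeff q\<close> sums to the mock theta function, the odd part to
  \<open>- 2 S1_at_1 q\<close>, and the whole to twice the theta quotient.\<close>

lemma S1_plus_theta:
  assumes q: "norm q < 1" and "q \<noteq> 0"
  shows "S1_at_1 q + (J 1 2 q)\<^sup>2 / J_bar 0 1 q
         = (1 / 2) * (\<Sum>n. (- 1) ^ n * q ^ (n\<^sup>2) * qpoch q (q\<^sup>2) n / (qpoch (- (q\<^sup>2)) (q\<^sup>2) n)\<^sup>2)"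
proof -
  define Q where "Q = q\<^sup>2"
  have Q: "norm Q < 1"
    using q by (simp add: Q_def norm_power abs_square_less_1)
  define A P R where "A = qpoch_inf q Q" and "P = qpoch_inf Q Q" and "R = qpoch_inf (- q) q"
  define c where "c = A / P"
  have nz: "A \<noteq> 0" "P \<noteq> 0" "R \<noteq> 0"
    unfolding A_def P_def R_def
    using qpoch_inf_self_nonzero[OF Q] qpoch_inf_minus_self_nonzero[OF q] qpoch_inf_odd_nonzero[OF q]
    by (simp_all add: Q_def)
  have qq: "qpoch_inf q q = A * P"
    unfolding A_def P_def Q_def by (rule qpoch_inf_even_odd[OF q])
  \<comment> \<open>In base \<open>q^2\<close> both \<open>x = q\<close> and \<open>q^2 / x\<close>
    equal \<open>q\<close>; this uses \<open>q \<noteq> 0\<close>.\<close>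
  have J: "J 1 2 q = A * A * P"
    using \<open>q \<noteq> 0\<close> by (simp add: J_def theta_j_def A_def P_def Q_def power2_eq_square)
  have "qpoch_inf (- 1) q = 2 * R"
    using qpoch_inf_split[OF q, of "- 1" 1] by (simp add: R_def qpoch_def)
  then have J': "J_bar 0 1 q = 2 * R * R * (A * P)"
    by (simp add: J_bar_def theta_j_def R_def qq)
  have "(\<lambda>j. c * bailey_coeff q (2 * j) + c * bailey_coeff q (2 * j + 1))
        sums (c * ((A * P)\<^sup>2 / R\<^sup>2))"
  proof -
    have "(\<lambda>n. sum (\<lambda>j. c * bailey_coeff q j) {n * 2..<n * 2 + 2}) sums (c * ((A * P)\<^sup>2 / R\<^sup>2))"
      using bailey_coeff_sums[OF q] by (intro sums_group sums_mult) (simp_all add: qq R_def)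
    then show ?thesis
      by (simp add: numeral_2_eq_2 mult.commute)
  qed
  moreover have "(\<lambda>j. c * bailey_coeff q (2 * j)) sums (\<Sum>j. c * bailey_coeff q (2 * j))"
    using mu_series_sums(1)[OF q] by (auto simp: c_def A_def P_def Q_def)
  moreover have s: "(\<lambda>j. c * bailey_coeff q (2 * j + 1)) sums (\<Sum>j. c * bailey_coeff q (2 * j + 1))"
    using summable_mult[OF S1_series_sums(1)[OF q], of "- 4"] by (auto simp: c_def A_def P_def Q_def)
  ultimately have sum: "(\<Sum>j. c * bailey_coeff q (2 * j)) + (\<Sum>j. c * bailey_coeff q (2 * j + 1))
      = c * ((A * P)\<^sup>2 / R\<^sup>2)"
    using sums_add sums_unique2 by blast
  have "S1_at_1 q = 2 * (\<Sum>j. - (1 / 4) * (c * bailey_coeff q (2 * j + 1)))"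
    unfolding S1_at_1_def using S1_series_sums(2)[OF q] by (simp add: sums_iff c_def A_def P_def Q_def)
  also have "\<dots> = - (1 / 2) * (\<Sum>j. c * bailey_coeff q (2 * j + 1))"
    using s by (subst suminf_mult) (auto simp: sums_iff)
  also have "\<dots> = (1 / 2) * (\<Sum>j. c * bailey_coeff q (2 * j)) - (1 / 2) * (c * ((A * P)\<^sup>2 / R\<^sup>2))"
    unfolding sum[symmetric] by (simp add: algebra_simps)
  also have "(1 / 2) * (c * ((A * P)\<^sup>2 / R\<^sup>2)) = (J 1 2 q)\<^sup>2 / J_bar 0 1 q"
    unfolding J J' c_def using nz by (simp add: field_simps power2_eq_square)
  also have "(\<Sum>j. c * bailey_coeff q (2 * j))
      = (\<Sum>n. (- 1) ^ n * q ^ (n\<^sup>2) * qpoch q (q\<^sup>2) n / (qpoch (- (q\<^sup>2)) (q\<^sup>2) n)\<^sup>2)"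
    using mu_series_sums(2)[OF q] by (simp add: sums_iff c_def A_def P_def Q_def)
  finally show ?thesis
    by simp
qed

section \<open>Evaluation at the root of unity\<close>

locale odd_root =
  fixes k :: nat and \<zeta> :: complex
  assumes odd_k: "odd k" and primitive: "primitive_root_of_unity (2 * k) \<zeta>"
begin

section \<open>Arithmetic of \<zeta> and products over a full period\<close>

lemma k_pos: "k > 0"
  using odd_k by (rule odd_pos)

lemma zeta_power_k: "\<zeta> ^ k = - 1"
proof -
  have "\<zeta> ^ k \<noteq> 1" "(\<zeta> ^ k)\<^sup>2 = 1"
    using primitive k_pos by (auto simp: primitive_root_of_unity_def mult.commute simp flip: power_mult)
  then show ?thesis
    by (simp add: power2_eq_1_iff)
qed

lemma zeta_nonzero: "\<zeta> \<noteq> 0"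
  using zeta_power_k k_pos by (auto simp: power_0_left)

lemma norm_zeta: "norm \<zeta> = 1"
proof -
  have "norm \<zeta> ^ k = 1"
    by (simp add: zeta_power_k flip: norm_power)
  then show ?thesis
    using power_eq_imp_eq_base[of "norm \<zeta>" k 1] k_pos by simp
qed

lemma zeta_sq_power_k: "(\<zeta>\<^sup>2) ^ k = 1"
  using zeta_power_k by (metis mult.commute power_mult power2_minus power_one)

lemma zeta_sq_powers_distinct: "inj_on (\<lambda>i. (\<zeta>\<^sup>2) ^ i) {..<k}"
proof (rule linorder_inj_onI)
  fix i j assume "i < j" "j \<in> {..<k}"
  show "(\<zeta>\<^sup>2) ^ i \<noteq> (\<zeta>\<^sup>2) ^ j"
  proof
    assume "(\<zeta>\<^sup>2) ^ i = (\<zeta>\<^sup>2) ^ j"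
    moreover have "\<zeta> ^ (2 * j) = \<zeta> ^ (2 * i) * \<zeta> ^ (2 * (j - i))"
    proof -
      have "2 * j = 2 * i + 2 * (j - i)"
        using \<open>i < j\<close> by simp
      then show ?thesis
        by (metis power_add)
    qed
    ultimately have "\<zeta> ^ (2 * i) * 1 = \<zeta> ^ (2 * i) * \<zeta> ^ (2 * (j - i))"
      by (simp add: power_mult)
    then have "\<zeta> ^ (2 * (j - i)) = 1"
      using zeta_nonzero by (metis mult_cancel_left power_not_zero)
    then show False
      using primitive \<open>i < j\<close> \<open>j \<in> {..<k}\<close> unfolding primitive_root_of_unity_def
      by (metis lessThan_iff less_imp_diff_less mult_less_cancel1 nat_0_less_mult_iff pos2 zero_less_diff)
  qed
qed auto

text \<open>The powers of \<open>\<zeta>^2\<close> run through all \<open>k\<close>-th roots of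
  unity, so the product is the factorization of \<open>1 - a^k\<close>.\<close>

lemma qpoch_period: "qpoch a (\<zeta>\<^sup>2) k = 1 - a ^ k"
proof -
  define p where "p = (\<Prod>i<k. [:1, - ((\<zeta>\<^sup>2) ^ i):])"
  \<comment> \<open>Polynomials of degree at most \<open>k\<close> are compared at
    \<open>k + 1\<close> points: the inverse roots of unity, and 0, which fixes the
    normalization.\<close>
  define A where "A = insert 0 ((\<lambda>i. inverse ((\<zeta>\<^sup>2) ^ i)) ` {..<k})"
  have "inj_on (\<lambda>i. inverse ((\<zeta>\<^sup>2) ^ i)) {..<k}"
    using zeta_sq_powers_distinct by (auto simp: inj_on_def)
  then have card: "card A = Suc k"
    using zeta_nonzero by (simp add: A_def card_insert_if card_image image_iff)
  have poly_p: "poly p x = (\<Prod>i<k. 1 - x * (\<zeta>\<^sup>2) ^ i)" for x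
    by (simp add: p_def poly_prod)
  have "p = 1 - monom 1 k"
  proof (rule poly_eqI_degree)
    fix x assume "x \<in> A"
    then consider "x = 0" | i where "i < k" "x = inverse ((\<zeta>\<^sup>2) ^ i)"
      by (auto simp: A_def)
    then show "poly p x = poly (1 - monom 1 k) x"
    proof cases
      case 1
      then show ?thesis
        using k_pos by (simp add: poly_p poly_monom)
    next
      case 2
      then have "(\<Prod>i<k. 1 - x * (\<zeta>\<^sup>2) ^ i) = 0"
        using zeta_nonzero by (intro prod_zero bexI[of _ i]) auto
      moreover have "x ^ k = inverse (((\<zeta>\<^sup>2) ^ k) ^ i)"
        using 2 by (simp add: power_inverse flip: power_mult) (simp add: mult_ac)
      ultimately show ?thesis
        by (simp add: poly_p poly_monom zeta_sq_power_k)
    qed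
  next
    have "degree p \<le> (\<Sum>i<k. degree [:1, - ((\<zeta>\<^sup>2) ^ i):])"
      using degree_prod_sum_le[of "{..<k}" "\<lambda>i. [:1, - ((\<zeta>\<^sup>2) ^ i):]"] by (simp add: p_def o_def)
    also have "\<dots> \<le> (\<Sum>i<k. 1)"
      by (intro sum_mono) simp
    finally show "card A > degree p"
      using card by simp
    show "card A > degree (1 - monom 1 k :: complex poly)"
      using degree_diff_le[of 1 k "monom 1 k :: complex poly"] card by (simp add: degree_monom_le)
  qed
  then have "poly p a = 1 - a ^ k"
    by (simp add: poly_monom)
  then show ?thesis
    by (simp add: poly_p qpoch_def)
qed

text \<open>For odd \<open>k\<close>, \<open>- 1\<close> is not a \<open>k\<close>-th root of unity.
  This keeps the denominators of the mock theta function nonzero at \<zeta>.\<close>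

lemma one_plus_nonzero:
  fixes u :: complex
  assumes "u ^ k = 1"
  shows "1 + u \<noteq> 0"
proof
  assume "1 + u = 0"
  then have "u = - 1"
    using minus_unique by metis
  then show False
    using assms odd_k by simp
qed

lemma qpoch_zeta_nonzero: "qpoch \<zeta> (\<zeta>\<^sup>2) n \<noteq> 0"
proof -
  have "\<zeta> * (\<zeta>\<^sup>2) ^ i \<noteq> 1" for i
  proof
    assume "\<zeta> * (\<zeta>\<^sup>2) ^ i = 1"
    then have "\<zeta> ^ k * ((\<zeta>\<^sup>2) ^ k) ^ i = 1"
      by (metis mult.commute power_mult power_mult_distrib power_one)
    then show False
      by (simp add: zeta_power_k zeta_sq_power_k)
  qed
  then show ?thesis
    by (simp add: qpoch_def)
qed

lemma qpoch_minus_nonzero: "u ^ k = 1 \<Longrightarrow> qpoch (- u) (\<zeta>\<^sup>2) n \<noteq> 0"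
proof -
  assume u: "u ^ k = 1"
  have "1 + u * (\<zeta>\<^sup>2) ^ i \<noteq> 0" for i
  proof (rule one_plus_nonzero)
    show "(u * (\<zeta>\<^sup>2) ^ i) ^ k = 1"
      by (metis u zeta_sq_power_k mult.commute mult_1 power_mult power_mult_distrib power_one)
  qed
  then show ?thesis
    by (simp add: qpoch_def)
qed

text \<open>The squared denominator is split by a parameter \<open>x\<close>, which makes a
  difference equation in \<open>x\<close> available; \<open>x = 1\<close> gives back the summand at
  \<zeta>.\<close>

definition mu_term :: "complex \<Rightarrow> nat \<Rightarrow> complex" where
  "mu_term x n = (- 1) ^ n * \<zeta> ^ (n\<^sup>2) * qpoch \<zeta> (\<zeta>\<^sup>2) n
     / (qpoch (- (x * \<zeta>\<^sup>2)) (\<zeta>\<^sup>2) n * qpoch (- (\<zeta>\<^sup>2 / x)) (\<zeta>\<^sup>2) n)"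

text \<open>Under \<open>x \<mapsto> x \<zeta>^2\<close> the two denominator products shift by one
  factor in opposite directions, so only end factors remain; dividing by \<open>1 + x\<close>
  absorbs those free of \<open>n\<close>.\<close>

lemma mu_term_shift:
  assumes x: "x ^ k = 1"
  shows "mu_term (x * \<zeta>\<^sup>2) n / (1 + x * \<zeta>\<^sup>2)
       = mu_term x n / (1 + x) * ((x + (\<zeta>\<^sup>2) ^ n) / (1 + x * (\<zeta>\<^sup>2) ^ Suc n))"
proof -
  define Q where "Q = \<zeta>\<^sup>2"
  define w where "w = Q ^ n"
  have "x \<noteq> 0"
    using x k_pos by (auto simp: power_0_left)
  have Qk: "Q ^ k = 1" and "Q \<noteq> 0"
    using zeta_sq_power_k zeta_nonzero by (simp_all add: Q_def)
  have wk: "w ^ k = 1"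
    using Qk by (metis w_def mult.commute power_mult power_one)
  have nz: "1 + x \<noteq> 0" "1 + x * Q \<noteq> 0" "1 + x * Q * w \<noteq> 0"
    using x Qk wk by (auto intro!: one_plus_nonzero simp: power_mult_distrib)
  define a b where "a = qpoch (- (x * Q)) Q n" and "b = qpoch (- (Q / x)) Q n"
  have ab: "a \<noteq> 0" "b \<noteq> 0"
    unfolding a_def b_def Q_def
    by (rule qpoch_minus_nonzero; use x Qk in \<open>simp add: power_mult_distrib power_divide Q_def\<close>)+
  have "qpoch (- (x * Q)) Q (1 + n) = qpoch (- (x * Q)) Q (n + 1)"
    by simp
  then have "(1 + x * Q) * qpoch (- (x * Q * Q)) Q n = a * (1 + x * Q * w)"
    unfolding qpoch_add by (simp add: qpoch_def a_def w_def)
  then have a': "qpoch (- (x * Q * Q)) Q n = a * (1 + x * Q * w) / (1 + x * Q)"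
    using nz by (simp add: field_simps)
  have b': "qpoch (- (Q / (x * Q))) Q n = b * (1 + x) / (x + w)"
  proof -
    have xw: "x + w \<noteq> 0"
    proof -
      have "1 + w / x \<noteq> 0"
        using wk x by (intro one_plus_nonzero) (simp add: power_divide)
      then show ?thesis
        using \<open>x \<noteq> 0\<close> by (auto simp: field_simps)
    qed
    have "qpoch (- (1 / x)) Q (1 + n) = qpoch (- (1 / x)) Q (n + 1)"
      by simp
    then have "(1 + 1 / x) * b = qpoch (- (1 / x)) Q n * (1 + w / x)"
      unfolding qpoch_add by (simp add: qpoch_def b_def w_def)
    then show ?thesis
      using \<open>x \<noteq> 0\<close> \<open>Q \<noteq> 0\<close> xw by (simp add: field_simps)
  qed
  show ?thesis
    unfolding mu_term_def Q_def[symmetric] a' b' power_Suc w_def[symmetric] a_def[symmetric] b_def[symmetric]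
    using nz ab by (simp add: mult_ac)
qed

text \<open>Termwise the combination telescopes through \<open>G\<close>. Over one period
  \<open>G\<close> falls to half its initial value, and this boundary contribution is the
  inhomogeneous term.\<close>

lemma mu_sum_shift:
  assumes x: "x ^ k = 1"
  shows "2 * (\<Sum>n<k. mu_term (x * \<zeta>\<^sup>2) n) / (1 + x * \<zeta>\<^sup>2)
       = \<zeta> * x\<^sup>2 * (2 * (\<Sum>n<k. mu_term x n) / (1 + x)) + (1 - \<zeta> * x)"
proof -
  define Q where "Q = \<zeta>\<^sup>2"
  define c where "c = 1 - \<zeta> * x"
  define G where "G n = - c * mu_term x n * (x + Q ^ n) / (1 + x)" for n
  have "x \<noteq> 0"
    using x k_pos by (auto simp: power_0_left)
  have Qk: "Q ^ k = 1" and "Q \<noteq> 0"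
    using zeta_sq_power_k zeta_nonzero by (simp_all add: Q_def)
  have "1 + x \<noteq> 0"
    using x by (rule one_plus_nonzero)
  have step: "mu_term (x * Q) n / (1 + x * Q) - \<zeta> * x\<^sup>2 * (mu_term x n / (1 + x)) = G (Suc n) - G n" for n
  proof -
    define w where "w = Q ^ n"
    define t where "t = mu_term x n"
    have wk: "w ^ k = 1"
      using Qk by (metis w_def mult.commute power_mult power_one)
    have nz: "1 + x * (Q * w) \<noteq> 0" "1 + Q * w / x \<noteq> 0"
      using x Qk wk by (auto intro!: one_plus_nonzero simp: power_mult_distrib power_divide)
    have nz': "x + Q * w \<noteq> 0"
      using nz \<open>x \<noteq> 0\<close> by (auto simp: field_simps)
    have "(Suc n)\<^sup>2 = n\<^sup>2 + (2 * n + 1)"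
      by (simp add: power2_eq_square)
    then have "\<zeta> ^ ((Suc n)\<^sup>2) = \<zeta> ^ (n\<^sup>2) * (w * \<zeta>)"
      by (simp only: power_add power_mult power_one_right w_def Q_def)
    then have "mu_term x (Suc n) = t * (- \<zeta> * w * (1 - \<zeta> * w) / ((1 + x * (Q * w)) * (1 + Q * w / x)))"
      unfolding mu_term_def t_def qpoch_Suc Q_def[symmetric] w_def[symmetric] by (simp add: mult_ac)
    also have "\<dots> = - t * \<zeta> * w * x * (1 - \<zeta> * w) / ((1 + x * (Q * w)) * (x + Q * w))"
      using nz nz' \<open>x \<noteq> 0\<close> by (simp add: field_simps)
    finally have "G (Suc n) = c * (t * \<zeta> * w * x * (1 - \<zeta> * w) / (1 + x * (Q * w))) / (1 + x)"
      using nz' by (simp add: G_def w_def)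
    moreover have "mu_term (x * Q) n / (1 + x * Q) = t / (1 + x) * ((x + w) / (1 + x * (Q * w)))"
      using mu_term_shift[OF x, of n] by (simp add: Q_def w_def t_def)
    moreover have "t / (1 + x) * ((x + w) / (1 + x * (Q * w))) - \<zeta> * x\<^sup>2 * (t / (1 + x))
        = c * (t * \<zeta> * w * x * (1 - \<zeta> * w) / (1 + x * (Q * w))) / (1 + x)
          - (- c * t * (x + w) / (1 + x))"
      using nz \<open>1 + x \<noteq> 0\<close>
      by (simp add: divide_simps Q_def c_def) (simp add: algebra_simps power2_eq_square)
    ultimately show ?thesis
      by (simp add: G_def w_def t_def)
  qed
  \<comment> \<open>Each of the three symbols of length \<open>k\<close> equals 2 by
    \<open>qpoch_period\<close>, and the signs cancel.\<close>
  have "mu_term x k = 1 / 2"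
  proof -
    have "qpoch \<zeta> Q k = 2" "qpoch (- (x * Q)) Q k = 2" "qpoch (- (Q / x)) Q k = 2"
      using odd_k x Qk by (simp_all add: Q_def qpoch_period zeta_power_k power_mult_distrib power_divide)
    moreover have "\<zeta> ^ (k\<^sup>2) = - 1"
      using odd_k by (simp add: power2_eq_square power_mult zeta_power_k)
    ultimately show ?thesis
      using odd_k by (simp add: mu_term_def Q_def)
  qed
  moreover have "mu_term x 0 = 1"
    by (simp add: mu_term_def)
  ultimately have "G k = - c / 2" "G 0 = - c"
    using \<open>1 + x \<noteq> 0\<close> Qk by (simp_all add: G_def add.commute)
  then have "G k - G 0 = c / 2"
    by simp
  then have "(\<Sum>n<k. mu_term (x * Q) n / (1 + x * Q) - \<zeta> * x\<^sup>2 * (mu_term x n / (1 + x))) = c / 2"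
    unfolding step by (simp add: sum_lessThan_telescope)
  then have "(\<Sum>n<k. mu_term (x * Q) n) / (1 + x * Q) - \<zeta> * x\<^sup>2 * ((\<Sum>n<k. mu_term x n) / (1 + x))
      = c / 2"
    by (simp only: sum_subtractf sum_distrib_left sum_divide_distrib)
  then show ?thesis
    by (simp add: Q_def c_def algebra_simps)
qed

text \<open>At \<open>x = 1\<close> this is the summand of the finite sum in the theorem;
  \<open>x\<close> plays the same role as in \<open>mu_term\<close>.\<close>

definition dual_term :: "complex \<Rightarrow> nat \<Rightarrow> complex" where
  "dual_term x n = \<zeta> ^ (2 * n + 1) * qpoch (- (x * \<zeta>)) (\<zeta>\<^sup>2) n * qpoch (- (\<zeta> / x)) (\<zeta>\<^sup>2) n
     / qpoch \<zeta> (\<zeta>\<^sup>2) (n + 1)"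

lemma dual_partial_sum:
  assumes "x \<noteq> 0"
  shows "(\<Sum>n\<le>m. (1 + x * \<zeta>\<^sup>2) * dual_term (x * \<zeta>\<^sup>2) n - \<zeta> ^ 3 * x\<^sup>2 * (1 + x) * dual_term x n)
       = \<zeta> * (1 - \<zeta>\<^sup>2 * x\<^sup>2) * qpoch (- (x * \<zeta>)) (\<zeta>\<^sup>2) (Suc m) * qpoch (- (\<zeta> / x)) (\<zeta>\<^sup>2) m
           / qpoch \<zeta> (\<zeta>\<^sup>2) (Suc m) - \<zeta>\<^sup>2 * x * (1 - \<zeta> * x)"
proof (induction m)
  case 0
  have "1 - \<zeta> \<noteq> 0"
    using qpoch_zeta_nonzero[of 1] by (simp add: qpoch_def)
  then show ?case
    by (simp add: dual_term_def qpoch_Suc divide_simps)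
       (simp add: algebra_simps power2_eq_square power3_eq_cube)
next
  case (Suc m)
  define Q where "Q = \<zeta>\<^sup>2"
  define w where "w = Q ^ Suc m"
  define a b d where "a = qpoch (- (x * \<zeta>)) Q (Suc m)" and "b = qpoch (- (\<zeta> / x)) Q m"
    and "d = qpoch \<zeta> Q (Suc m)"
  have d: "d \<noteq> 0" "1 - \<zeta> * w \<noteq> 0"
    using qpoch_zeta_nonzero[of "Suc m"] qpoch_zeta_nonzero[of "Suc (Suc m)"]
    unfolding qpoch_Suc[of _ _ "Suc m"] by (auto simp: d_def w_def Q_def)
  have zQ: "\<zeta> / x * Q ^ m = w / (x * \<zeta>)"
    using \<open>x \<noteq> 0\<close> zeta_nonzero by (simp add: w_def Q_def field_simps power2_eq_square)
  have a1: "qpoch (- (x * \<zeta>)) Q (Suc (Suc m)) = a * (1 + x * \<zeta> * w)"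
    unfolding qpoch_Suc[of _ _ "Suc m"] by (simp add: a_def w_def)
  have b1: "qpoch (- (\<zeta> / x)) Q (Suc m) = b * (1 + w / (x * \<zeta>))"
    unfolding qpoch_Suc using zQ by (simp add: b_def)
  have d1: "qpoch \<zeta> Q (Suc (Suc m)) = d * (1 - \<zeta> * w)"
    unfolding qpoch_Suc[of _ _ "Suc m"] by (simp add: d_def w_def)
  have z1: "\<zeta> ^ (2 * Suc m + 1) = \<zeta> * w"
    unfolding w_def Q_def power_mult[symmetric] by simp
  have "qpoch (- (x * \<zeta>)) Q (1 + Suc m) = a * (1 + x * \<zeta> * w)"
    using a1 by simp
  then have a2: "(1 + x * \<zeta>) * qpoch (- (x * Q * \<zeta>)) Q (Suc m) = a * (1 + x * \<zeta> * w)"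
    unfolding qpoch_add by (simp add: qpoch_def mult_ac)
  have b2: "qpoch (- (\<zeta> / (x * Q))) Q (Suc m) = (1 + x * \<zeta>) / (x * \<zeta>) * b"
  proof -
    have e: "\<zeta> / (x * Q) = 1 / (x * \<zeta>)" "1 / (x * \<zeta>) * Q = \<zeta> / x"
      using \<open>x \<noteq> 0\<close> zeta_nonzero by (simp_all add: Q_def field_simps power2_eq_square)
    have "qpoch (- (1 / (x * \<zeta>))) Q (1 + m) = (1 + 1 / (x * \<zeta>)) * b"
      unfolding qpoch_add b_def using e(2) by (simp add: qpoch_def)
    then show ?thesis
      unfolding e(1) using \<open>x \<noteq> 0\<close> zeta_nonzero by (simp add: field_simps)
  qed
  \<comment> \<open>Substituting \<open>w = v x \<zeta>\<close> clears the denominators in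
    \<open>x\<close>, and \<open>c\<close> collects the common factor; what remains is a polynomial
    identity.\<close>
  define v c where "v = w / (x * \<zeta>)" and "c = a * b / (d * (1 - \<zeta> * w))"
  have w: "w = v * x * \<zeta>"
    using \<open>x \<noteq> 0\<close> zeta_nonzero by (simp add: v_def)
  have t1: "dual_term x (Suc m) = c * (\<zeta> * w * (1 + v))"
    unfolding dual_term_def Q_def[symmetric] z1 using b1 d1 by (simp add: a_def c_def v_def mult_ac)
  have "dual_term (x * Q) (Suc m)
      = \<zeta> * w * ((1 + x * \<zeta>) * qpoch (- (x * Q * \<zeta>)) Q (Suc m)) / (x * \<zeta>) * b / (d * (1 - \<zeta> * w))"
    unfolding dual_term_def Q_def[symmetric] z1 b2 using d1 by simp
  then have t2: "dual_term (x * Q) (Suc m) = c * (\<zeta> * v * (1 + x * \<zeta> * w))"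
    unfolding a2 by (simp add: c_def v_def mult_ac)
  have r1: "\<zeta> * (1 - Q * x\<^sup>2) * (a * (1 + x * \<zeta> * w)) * (b * (1 + v)) / (d * (1 - \<zeta> * w))
      = c * (\<zeta> * (1 - Q * x\<^sup>2) * (1 + x * \<zeta> * w) * (1 + v))"
    by (simp add: c_def mult_ac)
  have r2: "\<zeta> * (1 - Q * x\<^sup>2) * a * b / d = c * (\<zeta> * (1 - Q * x\<^sup>2) * (1 - \<zeta> * w))"
    using d by (simp add: c_def)
  have "(1 + x * Q) * (\<zeta> * v * (1 + x * \<zeta> * w)) - \<zeta> ^ 3 * x\<^sup>2 * (1 + x) * (\<zeta> * w * (1 + v))
      = \<zeta> * (1 - Q * x\<^sup>2) * (1 + x * \<zeta> * w) * (1 + v) - \<zeta> * (1 - Q * x\<^sup>2) * (1 - \<zeta> * w)"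
    unfolding w Q_def by (simp add: algebra_simps power2_eq_square power3_eq_cube)
  from arg_cong[OF this, of "\<lambda>y. c * y"]
  have "(1 + x * Q) * dual_term (x * Q) (Suc m) - \<zeta> ^ 3 * x\<^sup>2 * (1 + x) * dual_term x (Suc m)
      = \<zeta> * (1 - Q * x\<^sup>2) * (a * (1 + x * \<zeta> * w)) * (b * (1 + v)) / (d * (1 - \<zeta> * w))
        - \<zeta> * (1 - Q * x\<^sup>2) * a * b / d"
    unfolding t1 t2 r1 r2 by (simp only: right_diff_distrib mult.left_commute)
  then show ?case
    unfolding sum.atMost_Suc Suc.IH unfolding Q_def[symmetric] a1 b1 d1 a_def[symmetric]
      b_def[symmetric] d_def[symmetric] v_def[symmetric] by simp
qed

text \<open>After a full period the product term of \<open>dual_partial_sum\<close> vanishes,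
  because \<open>(- x \<zeta>)^k = 1\<close>; only the constant is left.\<close>

lemma dual_sum_shift:
  assumes x: "x ^ k = 1"
  shows "(1 + x * \<zeta>\<^sup>2) * (\<Sum>n<k. dual_term (x * \<zeta>\<^sup>2) n)
       = \<zeta> ^ 3 * x\<^sup>2 * (1 + x) * (\<Sum>n<k. dual_term x n) - \<zeta>\<^sup>2 * x * (1 - \<zeta> * x)"
proof -
  have "x \<noteq> 0"
    using x k_pos by (auto simp: power_0_left)
  obtain m where m: "k = Suc m"
    using k_pos by (cases k) auto
  have "(- (x * \<zeta>)) ^ k = 1"
    using x odd_k by (simp add: power_mult_distrib zeta_power_k)
  then have "qpoch (- (x * \<zeta>)) (\<zeta>\<^sup>2) k = 0"
    by (simp add: qpoch_period)
  then have "(\<Sum>n<k. (1 + x * \<zeta>\<^sup>2) * dual_term (x * \<zeta>\<^sup>2) n - \<zeta> ^ 3 * x\<^sup>2 * (1 + x) * dual_term x n)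
      = - (\<zeta>\<^sup>2 * x * (1 - \<zeta> * x))"
    using dual_partial_sum[OF \<open>x \<noteq> 0\<close>, of m] by (simp add: m lessThan_Suc_atMost)
  then have "(1 + x * \<zeta>\<^sup>2) * (\<Sum>n<k. dual_term (x * \<zeta>\<^sup>2) n)
      - \<zeta> ^ 3 * x\<^sup>2 * (1 + x) * (\<Sum>n<k. dual_term x n) = - (\<zeta>\<^sup>2 * x * (1 - \<zeta> * x))"
    by (simp only: sum_subtractf sum_distrib_left)
  then show ?thesis
    by (simp add: algebra_simps)
qed

text \<open>The values \<open>A\<^sub>i\<close> and \<open>B\<^sub>i\<close> are those of one function \<open>H\<close> at \<open>\<zeta>\<^bsup>2i\<^esup>\<close> and \<open>\<zeta>\<^bsup>2i+1\<^esup>\<close>, satisfying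
  \<open>H(x \<zeta>\<^sup>2) = \<zeta> x\<^sup>2 H(x) + 1 - \<zeta> x\<close>. The defect \<open>E\<close> of the finer relation \<open>H(x \<zeta>) = 1 - x H(x)\<close> gets
  multiplied by \<open>- 1\<close> over a full period, hence vanishes.\<close>

lemma mu_dual_sum: "(\<Sum>n<k. mu_term 1 n) = - 2 * (\<Sum>n<k. dual_term 1 n)"
proof -
  define Q where "Q = \<zeta>\<^sup>2"
  define A where "A i = 2 * (\<Sum>n<k. mu_term (Q ^ i) n) / (1 + Q ^ i)" for i
  \<comment> \<open>The added 1 brings the inhomogeneous term to the form that the equation for
    \<open>A\<close> takes with \<open>x \<zeta>\<close> in place of \<open>x\<close>.\<close>
  define B where "B i = 1 + (1 + Q ^ i) * (\<Sum>n<k. dual_term (Q ^ i) n)" for i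
  define E where "E i = B i - 1 + Q ^ i * A i" for i
  have Qi: "(Q ^ i) ^ k = 1" for i
    by (metis Q_def zeta_sq_power_k mult.commute power_mult power_one)
  have A: "A (Suc i) = \<zeta> * (Q ^ i)\<^sup>2 * A i + (1 - \<zeta> * Q ^ i)" for i
    using mu_sum_shift[OF Qi, of i] by (simp add: A_def Q_def mult.commute)
  have B: "B (Suc i) = \<zeta> ^ 3 * (Q ^ i)\<^sup>2 * B i + (1 - \<zeta>\<^sup>2 * Q ^ i)" for i
    using dual_sum_shift[OF Qi, of i] by (simp add: B_def Q_def mult.commute algebra_simps power2_eq_square power3_eq_cube)
  have E: "E (Suc i) = \<zeta> ^ (4 * i + 3) * E i" for i
  proof -
    have "\<zeta> ^ (4 * i + 3) = \<zeta> ^ 3 * (Q ^ i)\<^sup>2"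
      by (simp add: Q_def power_add mult_ac flip: power_mult)
    then show ?thesis
      by (simp add: E_def A B Q_def algebra_simps power2_eq_square power3_eq_cube)
  qed
  have "E n = \<zeta> ^ (n * (2 * n + 1)) * E 0" for n
  proof (induction n)
    case (Suc n)
    have "Suc n * (2 * Suc n + 1) = 4 * n + 3 + n * (2 * n + 1)"
      by simp
    then show ?case
      unfolding E Suc.IH by (simp only: power_add mult.assoc)
  qed simp
  \<comment> \<open>The exponents \<open>4 i + 3\<close> add up to \<open>k (2k + 1)\<close>, and
    \<open>\<zeta>^k = - 1\<close>; hence the factor is \<open>- 1\<close>, while periodicity gives
    \<open>E k = E 0\<close>.\<close>
  from this[of k] have "E k = (- 1) ^ (2 * k + 1) * E 0"
    by (simp only: power_mult zeta_power_k)
  moreover have "E k = E 0"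
    using Qi[of 1] by (simp add: E_def A_def B_def)
  ultimately have "E 0 = 0"
    by simp
  then show ?thesis
    by (simp add: E_def A_def B_def add_eq_0_iff)
qed

end

section \<open>The radial limit\<close>

definition mu_summand :: "nat \<Rightarrow> complex \<Rightarrow> complex" where
  "mu_summand n q = (- 1) ^ n * q ^ (n\<^sup>2) * qpoch q (q\<^sup>2) n / (qpoch (- (q\<^sup>2)) (q\<^sup>2) n)\<^sup>2"

context odd_root
begin

text \<open>Quotient of summands one period apart, with \<open>w = q^(2n)\<close> kept as an
  independent variable so that all \<open>n\<close> are handled at once by compactness.\<close>

definition mu_ratio :: "complex \<Rightarrow> complex \<Rightarrow> complex" where
  "mu_ratio w q = (- 1) ^ k * q ^ (k\<^sup>2) * w ^ k * qpoch (q * w) (q\<^sup>2) k / (qpoch (- (q\<^sup>2 * w)) (q\<^sup>2) k)\<^sup>2"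

lemma mu_summand_zeta: "mu_summand n \<zeta> = mu_term 1 n"
  by (simp add: mu_summand_def mu_term_def power2_eq_square)

lemma mu_summand_add_period: "mu_summand (n + k) q = mu_summand n q * mu_ratio (q ^ (2 * n)) q"
proof -
  have "(n + k)\<^sup>2 = n\<^sup>2 + k\<^sup>2 + 2 * n * k"
    by (simp add: power2_eq_square algebra_simps)
  then have "q ^ ((n + k)\<^sup>2) = q ^ (n\<^sup>2) * q ^ (k\<^sup>2) * (q ^ (2 * n)) ^ k"
    by (simp only: power_add power_mult)
  moreover have "(q\<^sup>2) ^ n = q ^ (2 * n)"
    by (simp only: power_mult)
  ultimately show ?thesis
    by (simp add: mu_summand_def mu_ratio_def qpoch_add power_add power_mult_distrib)
qed

lemma norm_unit_root:
  fixes u :: complex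
  assumes "u ^ k = 1"
  shows "norm u = 1"
proof -
  have "norm u ^ k = 1"
    by (simp add: assms flip: norm_power)
  then show ?thesis
    using power_eq_imp_eq_base[of "norm u" k 1] k_pos by simp
qed

lemma one_plus_segment_nonzero:
  fixes u :: complex
  assumes "u ^ k = 1" and "s \<ge> 0"
  shows "1 + of_real s * u \<noteq> 0"
proof
  assume "1 + of_real s * u = 0"
  then have "of_real s * u = - 1"
    using minus_unique by metis
  then have "norm (of_real s * u) = 1"
    by simp
  then have "s = 1"
    using assms norm_unit_root by (simp add: norm_mult)
  with \<open>1 + of_real s * u = 0\<close> show False
    using one_plus_nonzero[OF assms(1)] by simp
qed

text \<open>With \<open>T = t^k\<close>, the numerator symbol and each denominator symbol equal
  \<open>1 + T\<close> by \<open>qpoch_period\<close>.\<close>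

lemma mu_ratio_zeta:
  assumes "u ^ k = 1" and "t \<ge> 0"
  shows "mu_ratio (of_real t * u) \<zeta> = of_real (t ^ k / (1 + t ^ k))"
proof -
  have "\<zeta> ^ (k\<^sup>2) = - 1"
    using odd_k by (simp add: power2_eq_square power_mult zeta_power_k)
  moreover have "qpoch (\<zeta> * (of_real t * u)) (\<zeta>\<^sup>2) k = 1 + of_real (t ^ k)"
    by (simp add: qpoch_period power_mult_distrib zeta_power_k assms)
  moreover have "qpoch (- (\<zeta>\<^sup>2 * (of_real t * u))) (\<zeta>\<^sup>2) k = 1 + of_real (t ^ k)"
    using odd_k by (simp add: qpoch_period power_mult_distrib zeta_sq_power_k assms)
  moreover have "1 + t ^ k > 0"
    using assms by (simp add: add_pos_nonneg)
  then have "(1 + of_real (t ^ k) :: complex) \<noteq> 0"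
    by (metis of_real_1 of_real_add of_real_eq_0_iff less_irrefl)
  ultimately show ?thesis
    using odd_k by (simp add: mu_ratio_def assms power_mult_distrib power2_eq_square)
qed

text \<open>On the limiting circle the ratio is \<open>T / (1 + T) \<le> 1/2\<close> with \<open>T = t\<^sup>k\<close> in \<open>[0, 1]\<close>, so uniform
  continuity on a compact set keeps it below \<open>3/4\<close> nearby, which yields a dominating geometric series.\<close>

lemma eventually_mu_ratio_le:
  "\<forall>\<^sub>F r in at_left (1::real). 0 < r \<and> r < 1 \<and>
     (\<forall>n. norm (mu_ratio ((of_real r * \<zeta>) ^ (2 * n)) (of_real r * \<zeta>)) \<le> 3 / 4)"
proof -
  \<comment> \<open>The \<open>k\<close> radial segments from 0 to the powers of
    \<open>\<zeta>^2\<close>: a compact set containing every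
    \<open>(r \<zeta>)^(2n)\<close>.\<close>
  define W where "W = (\<Union>m<k. (\<lambda>t. of_real t * (\<zeta>\<^sup>2) ^ m) ` {0..1::real})"
  have W: "\<exists>t u. w = of_real t * u \<and> 0 \<le> t \<and> t \<le> 1 \<and> u ^ k = 1" if "w \<in> W" for w
  proof -
    have "((\<zeta>\<^sup>2) ^ m) ^ k = 1" for m
      by (metis zeta_sq_power_k mult.commute power_mult power_one)
    moreover obtain m t where "w = of_real t * (\<zeta>\<^sup>2) ^ m" "0 \<le> t" "t \<le> 1"
      using \<open>w \<in> W\<close> unfolding W_def by auto
    ultimately show ?thesis
      by blast
  qed
  have mem: "(of_real r * \<zeta>) ^ (2 * n) \<in> W" if "0 < r" "r < 1" for r :: real and n
  proof -
    have "(\<zeta>\<^sup>2) ^ n = (\<zeta>\<^sup>2) ^ (k * (n div k) + n mod k)"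
      by simp
    also have "\<dots> = (\<zeta>\<^sup>2) ^ (n mod k)"
      unfolding power_add power_mult[of "\<zeta>\<^sup>2"] zeta_sq_power_k by simp
    finally have "(of_real r * \<zeta>) ^ (2 * n) = of_real (r ^ (2 * n)) * (\<zeta>\<^sup>2) ^ (n mod k)"
      by (simp add: power_mult_distrib power_mult)
    moreover have "r ^ (2 * n) \<in> {0..1}"
      using that by (simp add: power_le_one)
    ultimately have "(of_real r * \<zeta>) ^ (2 * n) \<in> (\<lambda>t. of_real t * (\<zeta>\<^sup>2) ^ (n mod k)) ` {0..1::real}"
      by (rule image_eqI)
    moreover have "n mod k < k"
      using k_pos by simp
    ultimately show ?thesis
      unfolding W_def by blast
  qed
  have "compact (W \<times> {0..1::real})"
    unfolding W_def by (intro compact_Times compact_UN compact_continuous_image continuous_intros) auto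
  moreover have "continuous_on (W \<times> {0..1::real}) (\<lambda>p. mu_ratio (fst p) (of_real (snd p) * \<zeta>))"
    unfolding mu_ratio_def qpoch_def
  proof (intro continuous_intros ballI)
    fix p assume p: "p \<in> W \<times> {0..1::real}"
    obtain w r where wr: "p = (w, r)" "w \<in> W" "0 \<le> r"
      using p by auto
    obtain t u where tu: "w = of_real t * u" "0 \<le> t" "u ^ k = 1"
      using W[OF wr(2)] by blast
    have "1 + (of_real r * \<zeta>)\<^sup>2 * w * ((of_real r * \<zeta>)\<^sup>2) ^ i \<noteq> 0" for i
    proof -
      have "1 + of_real (r\<^sup>2 * t * (r\<^sup>2) ^ i) * (\<zeta>\<^sup>2 * u * (\<zeta>\<^sup>2) ^ i) \<noteq> 0"
      proof (rule one_plus_segment_nonzero)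
        have "((\<zeta>\<^sup>2) ^ i) ^ k = 1"
          by (metis zeta_sq_power_k mult.commute power_mult power_one)
        then show "(\<zeta>\<^sup>2 * u * (\<zeta>\<^sup>2) ^ i) ^ k = 1"
          by (simp add: power_mult_distrib[of _ _ k] zeta_sq_power_k tu)
      qed (use tu wr in simp)
      then show ?thesis
        by (simp add: tu power_mult_distrib mult_ac)
    qed
    then show "(\<Prod>i<k. 1 - - ((of_real (snd p) * \<zeta>)\<^sup>2 * fst p) * ((of_real (snd p) * \<zeta>)\<^sup>2) ^ i)\<^sup>2 \<noteq> 0"
      by (simp add: wr)
  qed
  \<comment> \<open>The tolerance 1/4 is the gap between the bound 1/2 on the limiting circle and
    the target 3/4.\<close>
  ultimately obtain d where d: "d > 0"
    "\<And>p p'. p \<in> W \<times> {0..1::real} \<Longrightarrow> p' \<in> W \<times> {0..1::real} \<Longrightarrow> dist p' p < d \<Longrightarrow>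
       dist (mu_ratio (fst p') (of_real (snd p') * \<zeta>)) (mu_ratio (fst p) (of_real (snd p) * \<zeta>)) < 1 / 4"
    using compact_uniformly_continuous[of "W \<times> {0..1::real}" "\<lambda>p. mu_ratio (fst p) (of_real (snd p) * \<zeta>)"]
    unfolding uniformly_continuous_on_def by (meson zero_less_divide_1_iff zero_less_numeral)
  have bound: "norm (mu_ratio w (of_real r * \<zeta>)) \<le> 3 / 4"
    if "w \<in> W" "0 < r" "r < 1" "1 - d < r" for w and r :: real
  proof -
    obtain t u where tu: "w = of_real t * u" "0 \<le> t" "t \<le> 1" "u ^ k = 1"
      using W[OF \<open>w \<in> W\<close>] by blast
    have "norm (mu_ratio w \<zeta>) = t ^ k / (1 + t ^ k)"
      unfolding tu(1) mu_ratio_zeta[OF tu(4,2)] norm_of_real using tu by simp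
    also have "\<dots> \<le> 1 / 2"
      using tu by (simp add: field_simps power_le_one add_pos_nonneg)
    finally have "norm (mu_ratio w \<zeta>) \<le> 1 / 2" .
    moreover have "dist (mu_ratio w (of_real r * \<zeta>)) (mu_ratio w \<zeta>) < 1 / 4"
      using d(2)[of "(w, 1)" "(w, r)"] that by (simp add: dist_Pair_Pair dist_real_def)
    ultimately show ?thesis
      using norm_triangle_sub[of "mu_ratio w (of_real r * \<zeta>)" "mu_ratio w \<zeta>"]
      by (simp add: dist_norm)
  qed
  show ?thesis
    by (rule eventually_at_leftI[of "max 0 (1 - d)"]) (use bound mem \<open>d > 0\<close> in auto)
qed

lemma mu_summand_tendsto: "((\<lambda>r. mu_summand n (of_real r * \<zeta>)) \<longlongrightarrow> mu_term 1 n) (at_left (1::real))"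
proof -
  have "((\<lambda>r. mu_summand n (of_real r * \<zeta>)) \<longlongrightarrow> mu_summand n (of_real 1 * \<zeta>)) (at_left (1::real))"
    unfolding mu_summand_def qpoch_def
    by (intro tendsto_intros)
       (use qpoch_minus_nonzero[OF zeta_sq_power_k, of n] in \<open>simp add: qpoch_def\<close>)
  then show ?thesis
    by (simp add: mu_summand_zeta)
qed

text \<open>Tannery's theorem gives the full series at \<zeta>. Its terms halve after each period,
  so it equals its first period plus half of itself.\<close>

lemma mu_series_tendsto:
  "((\<lambda>r. \<Sum>n. mu_summand n (of_real r * \<zeta>)) \<longlongrightarrow> 2 * (\<Sum>n<k. mu_term 1 n)) (at_left (1::real))"
proof -
  define C where "C = (\<Sum>n<k. norm (mu_term 1 n) + 1)"
  \<comment> \<open>A factor 3/4 per period means a factor \<open>s\<close> per step; dividing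
    \<open>C\<close> by 3/4 covers \<open>n < k\<close>, where \<open>s^n\<close> is at least
    3/4.\<close>
  define s where "s = root k (3 / 4)"
  have s: "0 < s" "s < 1" "s ^ k = 3 / 4"
    using k_pos by (simp_all add: s_def real_root_pow_pos)
  have "\<forall>\<^sub>F r in at_left (1::real). \<forall>n\<in>{..<k}. norm (mu_summand n (of_real r * \<zeta>)) < norm (mu_term 1 n) + 1"
    by (intro eventually_ball_finite ballI order_tendstoD(2)[OF tendsto_norm[OF mu_summand_tendsto]]) auto
  then have "\<forall>\<^sub>F r in at_left (1::real). \<forall>n. norm (mu_summand n (of_real r * \<zeta>)) \<le> C / (3 / 4) * s ^ n"
    using eventually_mu_ratio_le
  proof eventually_elim
    case (elim r)
    show ?case
    proof
      fix n
      show "norm (mu_summand n (of_real r * \<zeta>)) \<le> C / (3 / 4) * s ^ n"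
      proof (induction n rule: less_induct)
        case (less n)
        show ?case
        proof (cases "n < k")
          case True
          have "norm (mu_summand n (of_real r * \<zeta>)) \<le> norm (mu_term 1 n) + 1"
            using elim(1) True by (simp add: less_imp_le)
          also have "\<dots> \<le> C"
            unfolding C_def using True by (intro member_le_sum) auto
          finally have le: "norm (mu_summand n (of_real r * \<zeta>)) \<le> C" .
          then have "C \<ge> 0"
            using norm_ge_zero order_trans by blast
          have "s ^ k \<le> s ^ n"
            using s True by (intro power_decreasing) auto
          then have "C * 1 \<le> C * (s ^ n / (3 / 4))"
            using \<open>C \<ge> 0\<close> s(3) by (intro mult_left_mono) auto
          with le show ?thesis
            by simp
        next
          case False
          then obtain m where n: "n = m + k"
            by (metis add.commute le_Suc_ex not_less)
          have "norm (mu_summand n (of_real r * \<zeta>))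
              = norm (mu_summand m (of_real r * \<zeta>)) * norm (mu_ratio ((of_real r * \<zeta>) ^ (2 * m)) (of_real r * \<zeta>))"
            unfolding n mu_summand_add_period norm_mult ..
          also have "\<dots> \<le> C / (3 / 4) * s ^ m * (3 / 4)"
            using less.IH[of m] order_trans[OF norm_ge_zero less.IH[of m]] elim(2) k_pos n
            by (intro mult_mono) auto
          also have "\<dots> = C / (3 / 4) * s ^ n"
            using s(3) by (simp add: n power_add)
          finally show ?thesis .
        qed
      qed
    qed
  qed
  then have bound: "\<forall>\<^sub>F (n, r) in at_top \<times>\<^sub>F at_left 1. norm (mu_summand n (of_real r * \<zeta>)) \<le> C / (3 / 4) * s ^ n"
    by (subst eventually_prod_filter)
       (intro exI[of _ "\<lambda>_. True"] exI[of _ "\<lambda>r. \<forall>n. norm (mu_summand n (of_real r * \<zeta>)) \<le> C / (3 / 4) * s ^ n"], auto)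
  have summable: "summable (\<lambda>n. C / (3 / 4) * s ^ n)"
    using s by (intro summable_mult summable_geometric) auto
  have T: "summable (\<lambda>n. norm (mu_term 1 n))"
    "((\<lambda>r. \<Sum>n. mu_summand n (of_real r * \<zeta>)) \<longlongrightarrow> (\<Sum>n. mu_term 1 n)) (at_left (1::real))"
    using tannerys_theorem[OF mu_summand_tendsto bound summable trivial_limit_at_left_real] by simp_all
  have half: "mu_term 1 (n + k) = mu_term 1 n * (1 / 2)" for n
  proof -
    have "((\<zeta>\<^sup>2) ^ n) ^ k = 1"
      by (metis zeta_sq_power_k mult.commute power_mult power_one)
    from mu_ratio_zeta[OF this, of 1] have "mu_ratio (\<zeta> ^ (2 * n)) \<zeta> = 1 / 2"
      by (simp add: power_mult)
    then show ?thesis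
      using mu_summand_add_period[of n \<zeta>] by (simp add: mu_summand_zeta)
  qed
  have "(\<Sum>n. mu_term 1 n) = (\<Sum>n. mu_term 1 n * (1 / 2)) + (\<Sum>n<k. mu_term 1 n)"
    using suminf_split_initial_segment[OF summable_norm_cancel[OF T(1)], of k] by (simp only: half)
  also have "(\<Sum>n. mu_term 1 n * (1 / 2)) = (\<Sum>n. mu_term 1 n) * (1 / 2)"
    by (rule suminf_mult2[symmetric]) (rule summable_norm_cancel[OF T(1)])
  finally have "(\<Sum>n. mu_term 1 n) - (\<Sum>n. mu_term 1 n) * (1 / 2) = (\<Sum>n<k. mu_term 1 n)"
    by (metis add_diff_cancel_left')
  then have "(\<Sum>n. mu_term 1 n) = 2 * (\<Sum>n<k. mu_term 1 n)"
    by (simp add: field_simps)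
  with T(2) show ?thesis
    by simp
qed

text \<open>The factor of index \<open>(k - 1) div 2\<close> in
  \<open>(- \<zeta>;\<zeta>^2)_n\<close> is \<open>1 + \<zeta>^k = 0\<close>, which kills all later
  terms.\<close>

lemma dual_sum_truncated:
  "(\<Sum>n<k. dual_term 1 n) = (\<Sum>n = 0..(k - 1) div 2. dual_term 1 n)"
proof (rule sum.mono_neutral_right)
  show "{0..(k - 1) div 2} \<subseteq> {..<k}"
    using k_pos by auto
  show "\<forall>n\<in>{..<k} - {0..(k - 1) div 2}. dual_term 1 n = 0"
  proof
    fix n assume "n \<in> {..<k} - {0..(k - 1) div 2}"
    then have "(k - 1) div 2 < n"
      by auto
    have "k = 2 * ((k - 1) div 2) + 1"
      using odd_k by (auto elim!: oddE)
    then have "\<zeta> * (\<zeta>\<^sup>2) ^ ((k - 1) div 2) = - 1"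
      using zeta_power_k by (metis Suc_eq_plus1 power_Suc power_mult)
    then have "qpoch (- \<zeta>) (\<zeta>\<^sup>2) n = 0"
      unfolding qpoch_def using \<open>(k - 1) div 2 < n\<close> by (intro prod_zero bexI[of _ "(k - 1) div 2"]) auto
    then show "dual_term 1 n = 0"
      by (simp add: dual_term_def)
  qed
qed auto

end

theorem theorem4p1:
  fixes k :: nat and \<zeta> :: complex
  assumes "odd k" and "primitive_root_of_unity (2 * k) \<zeta>"
  shows "((\<lambda>r::real. let q = complex_of_real r * \<zeta> in
             S1_at_1 q + (J 1 2 q) ^ 2 / J_bar 0 1 q)
          \<longlongrightarrow> - 2 * (\<Sum>n = 0..(k - 1) div 2.
                  \<zeta> ^ (2 * n + 1) * (qpoch (- \<zeta>) (\<zeta> ^ 2) n) ^ 2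
                  / qpoch \<zeta> (\<zeta> ^ 2) (n + 1)))
         (at_left 1)"
proof -
  interpret odd_root k \<zeta>
    by standard (fact assms)+
  have "((\<lambda>r. 1 / 2 * (\<Sum>n. mu_summand n (of_real r * \<zeta>))) \<longlongrightarrow> 1 / 2 * (2 * (\<Sum>n<k. mu_term 1 n)))
      (at_left (1::real))"
    by (intro tendsto_intros mu_series_tendsto)
  also have "1 / 2 * (2 * (\<Sum>n<k. mu_term 1 n)) = - 2 * (\<Sum>n = 0..(k - 1) div 2. dual_term 1 n)"
    by (simp add: mu_dual_sum dual_sum_truncated)
  also have "(\<Sum>n = 0..(k - 1) div 2. dual_term 1 n)
      = (\<Sum>n = 0..(k - 1) div 2. \<zeta> ^ (2 * n + 1) * (qpoch (- \<zeta>) (\<zeta> ^ 2) n) ^ 2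
                  / qpoch \<zeta> (\<zeta> ^ 2) (n + 1))"
    by (simp add: dual_term_def power2_eq_square mult.assoc)
  finally show ?thesis
  proof (rule Lim_transform_eventually)
    show "\<forall>\<^sub>F r in at_left (1::real). 1 / 2 * (\<Sum>n. mu_summand n (of_real r * \<zeta>))
        = (let q = complex_of_real r * \<zeta> in S1_at_1 q + (J 1 2 q) ^ 2 / J_bar 0 1 q)"
    proof (rule eventually_at_leftI[of 0])
      \<comment> \<open>For these \<open>r\<close> the point \<open>r \<zeta>\<close> is nonzero and
        inside the disk, as \<open>S1_plus_theta\<close> requires.\<close>
      fix r :: real assume "r \<in> {0<..<1}"
      then show "1 / 2 * (\<Sum>n. mu_summand n (of_real r * \<zeta>))
        = (let q = complex_of_real r * \<zeta> in S1_at_1 q + (J 1 2 q) ^ 2 / J_bar 0 1 q)"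
        using S1_plus_theta[of "of_real r * \<zeta>"]
        by (simp add: Let_def mu_summand_def norm_mult norm_zeta zeta_nonzero)
    qed simp
  qed
qed

end
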